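(* Let $T$ be a Calderón-Zygmund operator and $b\in BMO$. It is not possible to find a finite set of $\eta$-sparse families $\{\mathcal{S}_j\}_{j=1}^{N}$, with $N$ dimensional (that is, $N$ depending only on the dimension $n$), contained in the same or in different dyadic lattices $\mathcal{D}_j$ and depending on $f$, such that $$|[b,T]f(x)|\leq c_{b,T}\sum_{j=1}^{N}B_{\mathcal{S}_j}f(x)\qquad\text{a.e. }x\in\mathbb{R}^n,$$ where $B_{\mathcal{S}_j}f(x)=\sum_{Q\in\mathcal{S}_j}\|f\|_{L\log L,Q}\,\chi_Q(x)$.
   Context: Cubes in $\mathbb{R}^n$ have sides parallel to the axes. A dyadic child of a cube $Q$ is any of the $2^n$ cubes obtained by partitioning $Q$ by $n$ median hyperplanes (planes parallel to the faces of $Q$ and dividing each edge into two equal parts). $\mathcal{D}(Q)$ denotes the standard dyadic lattice of subcubes of $Q$ obtained by iterating this partition process (including $Q$ itself). A dyadic lattice $\mathcal{D}$ in $\mathbb{R}^n$ is any collection of cubes such that: (DL-1) if $Q\in\mathcal{D}$, then each dyadic child of $Q$ is in $\mathcal{D}$ as well; (DL-2) if $Q',Q''\in\mathcal{D}$, there exists $Q\in\mathcal{D}$ such that $Q',Q''\in\mathcal{D}(Q)$; (DL-3) if $K$ is a compact set of $\mathbb{R}^n$, there exists $Q\in\mathcal{D}$ such that $K\subseteq Q$. For $\eta\in(0,1)$, a family of cubes $\mathcal{S}\subseteq\mathcal{D}$ is $\eta$-sparse if for each $Q\in\mathcal{S}$ there is a measurable subset $E(Q)\subset Q$ such that the sets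 $E(Q)$ are pairwise disjoint and $\eta|Q|\leq|E(Q)|$. With $\Phi(t)=t\log(e+t)$, the $L\log L$ average of $f$ on $Q$ is the Luxemburg norm $\|f\|_{L\log L,Q}=\inf\{\lambda>0:\frac{1}{|Q|}\int_Q\Phi(|f(x)|/\lambda)\,dx\leq1\}$. A Calderón-Zygmund operator is a singular integral operator $T$, bounded on $L^2(\mathbb{R}^n)$, given for $x\notin\operatorname{supp}f$ by $Tf(x)=\int_{\mathbb{R}^n}K(x,y)f(y)\,dy$ with a kernel $K$ satisfying the standard Calderón-Zygmund estimates. $BMO$ is the space of locally integrable functions $b$ with $\|b\|_{BMO}=\sup_Q\frac{1}{|Q|}\int_Q|b-b_Q|<\infty$, where $b_Q=\frac{1}{|Q|}\int_Q b$. The commutator is $[b,T]f=b\,T(f)-T(bf)$. The constant $c_{b,T}$ depends on $b$ and $T$. *)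

theory Defs
  imports "HOL-Analysis.Analysis"
begin

text \<open>Cubes are half-open, so that the dyadic children of a cube partition it exactly.\<close>

definition cube :: "real ^ 'n \<Rightarrow> real \<Rightarrow> (real ^ 'n) set" where
  "cube a l = {x. \<forall>i. a $ i \<le> x $ i \<and> x $ i < a $ i + l}"

definition cubes :: "(real ^ 'n) set set" where
  "cubes = {cube a l | a l. l > 0}"

definition dyadic_children :: "(real ^ 'n) set \<Rightarrow> (real ^ 'n) set set" where
  "dyadic_children Q =
     {cube a' (l / 2) | a a' l. l > 0 \<and> Q = cube a l \<and> (\<forall>i. a' $ i \<in> {a $ i, a $ i + l / 2})}"

inductive_set dyadic_subcubes :: "(real ^ 'n) set \<Rightarrow> (real ^ 'n) set set"
  for Q :: "(real ^ 'n) set" where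
  self: "Q \<in> dyadic_subcubes Q"
| child: "\<lbrakk>P \<in> dyadic_subcubes Q; P' \<in> dyadic_children P\<rbrakk> \<Longrightarrow> P' \<in> dyadic_subcubes Q"

definition dyadic_lattice :: "(real ^ 'n) set set \<Rightarrow> bool" where
  "dyadic_lattice D \<longleftrightarrow>
     D \<subseteq> cubes \<and>
     (\<forall>Q\<in>D. dyadic_children Q \<subseteq> D) \<and>
     (\<forall>Q'\<in>D. \<forall>Q''\<in>D. \<exists>Q\<in>D. Q' \<in> dyadic_subcubes Q \<and> Q'' \<in> dyadic_subcubes Q) \<and>
     (\<forall>K. compact K \<longrightarrow> (\<exists>Q\<in>D. K \<subseteq> Q))"

definition sparse_family :: "real \<Rightarrow> (real ^ 'n) set set \<Rightarrow> bool" where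
  "sparse_family \<eta> S \<longleftrightarrow>
     (\<exists>E. (\<forall>Q\<in>S. E Q \<in> sets lebesgue \<and> E Q \<subseteq> Q \<and>
                  \<eta> * measure lebesgue Q \<le> measure lebesgue (E Q)) \<and>
          disjoint_family_on E S)"

definition Phi :: "real \<Rightarrow> real" where
  "Phi t = t * ln (exp 1 + t)"

text \<open>The average is extended-valued: it is infinite if no \<open>t\<close> is admissible.\<close>

definition LlogL_average :: "(real ^ 'n \<Rightarrow> real) \<Rightarrow> (real ^ 'n) set \<Rightarrow> ennreal" where
  "LlogL_average f Q =
     Inf {ennreal t | t. t > 0 \<and>
       (\<integral>\<^sup>+x\<in>Q. ennreal (Phi (\<bar>f x\<bar> / t)) \<partial>lebesgue) / emeasure lebesgue Q \<le> 1}"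

definition sparse_LlogL :: "(real ^ 'n) set set \<Rightarrow> (real ^ 'n \<Rightarrow> real) \<Rightarrow> real ^ 'n \<Rightarrow> ennreal" where
  "sparse_LlogL S f x = (\<Sum>\<^sub>\<infinity>Q\<in>S. LlogL_average f Q * indicator Q x)"

definition mean :: "(real ^ 'n) set \<Rightarrow> (real ^ 'n \<Rightarrow> real) \<Rightarrow> real" where
  "mean Q f = set_lebesgue_integral lebesgue Q f / measure lebesgue Q"

definition BMO_norm :: "(real ^ 'n \<Rightarrow> real) \<Rightarrow> ennreal" where
  "BMO_norm b = (SUP Q\<in>cubes. ennreal (mean Q (\<lambda>x. \<bar>b x - mean Q b\<bar>)))"

definition BMO :: "(real ^ 'n \<Rightarrow> real) set" where
  "BMO = {b. (\<forall>K. compact K \<longrightarrow> set_integrable lebesgue K b) \<and> BMO_norm b < \<infinity>}"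

definition supp :: "(real ^ 'n \<Rightarrow> real) \<Rightarrow> (real ^ 'n) set" where
  "supp f = closure {x. f x \<noteq> 0}"

definition L2 :: "(real ^ 'n \<Rightarrow> real) set" where
  "L2 = {f. f \<in> borel_measurable lebesgue \<and> integrable lebesgue (\<lambda>x. (f x)\<^sup>2)}"

definition L2_norm :: "(real ^ 'n \<Rightarrow> real) \<Rightarrow> real" where
  "L2_norm f = sqrt (\<integral>x. (f x)\<^sup>2 \<partial>lebesgue)"

text \<open>Essentially bounded functions with compact support. If \<open>b\<close> is in BMO then \<open>b f\<close> is in \<open>L2\<close>
  for all such \<open>f\<close> (John--Nirenberg), so that the commutator below is defined on them.\<close>

definition Linfty_c :: "(real ^ 'n \<Rightarrow> real) set" where
  "Linfty_c = {f. f \<in> borel_measurable lebesgue \<and> (\<exists>M. AE x in lebesgue. \<bar>f x\<bar> \<le> M) \<and> compact (supp f)}"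

definition standard_kernel :: "(real ^ 'n \<Rightarrow> real ^ 'n \<Rightarrow> real) \<Rightarrow> bool" where
  "standard_kernel K \<longleftrightarrow>
     (\<exists>C \<delta>. 0 < \<delta> \<and> \<delta> \<le> 1 \<and>
        (\<forall>x y. x \<noteq> y \<longrightarrow> \<bar>K x y\<bar> \<le> C / norm (x - y) ^ CARD('n)) \<and>
        (\<forall>x x' y. 2 * norm (x - x') < norm (x - y) \<longrightarrow>
           \<bar>K x y - K x' y\<bar> + \<bar>K y x - K y x'\<bar>
             \<le> C * norm (x - x') powr \<delta> / norm (x - y) powr (real CARD('n) + \<delta>)))"

text \<open>Elements of \<open>L2\<close> are functions rather than equivalence classes, so linearity and the kernel
  representation are required almost everywhere. Linearity and boundedness together make \<open>T\<close>
  respect almost everywhere equality; the values of \<open>T\<close> outside \<open>L2\<close> are irrelevant.\<close>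

definition calderon_zygmund :: "((real ^ 'n \<Rightarrow> real) \<Rightarrow> real ^ 'n \<Rightarrow> real) \<Rightarrow> bool" where
  "calderon_zygmund T \<longleftrightarrow>
     (\<forall>f\<in>L2. \<forall>g\<in>L2. \<forall>\<alpha> \<beta>.
        AE x in lebesgue. T (\<lambda>y. \<alpha> * f y + \<beta> * g y) x = \<alpha> * T f x + \<beta> * T g x) \<and>
     (\<exists>C. \<forall>f\<in>L2. T f \<in> L2 \<and> L2_norm (T f) \<le> C * L2_norm f) \<and>
     (\<exists>K. standard_kernel K \<and>
        (\<forall>f\<in>L2. AE x in lebesgue. x \<notin> supp f \<longrightarrow> T f x = (\<integral>y. K x y * f y \<partial>lebesgue)))"

definition commutator ::
  "(real ^ 'n \<Rightarrow> real) \<Rightarrow> ((real ^ 'n \<Rightarrow> real) \<Rightarrow> real ^ 'n \<Rightarrow> real) \<Rightarrow>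
   (real ^ 'n \<Rightarrow> real) \<Rightarrow> real ^ 'n \<Rightarrow> real" where
  "commutator b T f x = b x * T f x - T (\<lambda>y. b y * f y) x"

end

(* The counterexample is of Hardy type. The kernel 1 / (|x| + |y|)^n is positive, so that L2-boundedness is
   Schur's test; b = ln |x|, and f is the indicator of the annulus 2^-m <= |y| < 1. For |x| < 2^-m
   we have b y >= b x on the annulus, so no cancellation occurs in the commutator, and [b,T]f is of size m^2
   on the whole ball of radius 2^-m. The mean over that ball of a sparse sum is only O(m): a point lies
   in at most one cube per dyadic scale, the averages of f are bounded and decay geometrically on scales beyond 1,
   which leaves the m scales between 2^-m and 1, and the cubes smaller than the ball are controlled
   on average by sparseness. *)
theory Submission
  imports Defs
begin

section \<open>Radial integrals\<close>

text \<open>One operator and one function \<open>b\<close> serve for every N: the constant c is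
  fixed before f, so m may tend to infinity once N and c are known. The two factors m have different
  sources. The annulus consists of m dyadic shells, on each of which kernel times volume is bounded
  below, and on the k-th shell the logarithms differ by at least k ln 2. A sparse sum can count the
  shells, but an indicator has bounded L log L averages on all cubes, so nothing in the sum matches
  the second factor.

  The obstacle is that lattices and families may be chosen after f. Every upper estimate therefore
  has to be uniform over all dyadic lattices and may use of the family nothing but \<eta>. A uniform
  pointwise bound is out of reach, since arbitrarily many small cubes of a sparse family can share a
  point. This is why means over the ball are compared: cubes of side below r that meet the ball of
  radius r lie in a fixed dilate of it, so their total volume is at most a constant times r^n /
  \<eta>, whatever r is.\<close>

definition nvol :: "real ^ 'n \<Rightarrow> real" where
  "nvol x = norm x ^ CARD('n)"

lemma nvol_nonneg [simp]: "0 \<le> nvol x"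
  by (simp add: nvol_def)

lemma nvol_pos_iff [simp]: "0 < nvol (x :: real ^ 'n) \<longleftrightarrow> x \<noteq> 0"
  unfolding nvol_def by (metis less_irrefl norm_zero power_0_left zero_less_card_finite zero_less_norm_iff zero_less_power)

lemma nvol_0 [simp]: "nvol 0 = 0"
  by (simp add: nvol_def)

lemma nvol_eq_0_iff [simp]: "nvol x = 0 \<longleftrightarrow> x = 0"
  by (simp add: nvol_def)

lemma borel_measurable_nvol [measurable (raw)]:
  "f \<in> borel_measurable M \<Longrightarrow> (\<lambda>x. nvol (f x)) \<in> borel_measurable M"
  unfolding nvol_def[abs_def] by measurable

text \<open>Taking the n-th power of the norm as radial variable makes the distribution function
  linear, so the dimension enters the radial integrals only through the volume of the unit
  ball.\<close>

lemma emeasure_nvol_less: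
  assumes "0 < t"
  shows "emeasure lborel {x :: real ^ 'n. nvol x < t} = ennreal (unit_ball_vol (real CARD('n)) * t)"
proof -
  define r where "r = root CARD('n) t"
  have r: "0 < r" "r ^ CARD('n) = t"
    using assms by (simp_all add: r_def)
  have "nvol x < t \<longleftrightarrow> norm x < r" for x :: "real ^ 'n"
    using power_mono_iff[of r "norm x" "CARD('n)"] r by (auto simp: nvol_def intro!: power_strict_mono)
  then have "{x :: real ^ 'n. nvol x < t} = ball 0 r"
    by (intro set_eqI) (simp only: mem_Collect_eq mem_ball_0)
  also have "emeasure lborel \<dots> = ennreal (unit_ball_vol (real CARD('n)) * t)"
    using emeasure_ball[of r "0 :: real ^ 'n"] r by simp
  finally show ?thesis .
qed

text \<open>This does the work of polar coordinates: g is dominated by the sum of \<open>c k\<close>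
  times the indicator of {\<open>nvol\<close> < \<open>t k\<close>}, and the integrals of these
  terms form a geometric series with ratio 1/2.\<close>

lemma nn_integral_le_radial_series:
  fixes g :: "real ^ 'n \<Rightarrow> ennreal"
  assumes c: "\<And>k. 0 \<le> c k" and t: "\<And>k. 0 < t k" and s: "\<And>k. c k * t k = A * (1 / 2) ^ k"
    and le: "\<And>x. g x \<noteq> 0 \<Longrightarrow> \<exists>k. nvol x < t k \<and> g x \<le> ennreal (c k)"
  shows "(\<integral>\<^sup>+x. g x \<partial>lborel) \<le> ennreal (2 * A * unit_ball_vol (real CARD('n)))"
proof -
  have A: "0 \<le> A"
    using s[of 0] mult_nonneg_nonneg[OF c less_imp_le[OF t], of 0 0] by simp
  have "g x \<le> (\<Sum>k. ennreal (c k) * indicator {x. nvol x < t k} x)" for x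
  proof (cases "g x = 0")
    case False
    then obtain k where k: "nvol x < t k" "g x \<le> ennreal (c k)"
      using le by blast
    then have "g x \<le> (\<Sum>i\<in>{k}. ennreal (c i) * indicator {x. nvol x < t i} x)"
      by simp
    also have "\<dots> \<le> (\<Sum>k. ennreal (c k) * indicator {x. nvol x < t k} x)"
      by (rule sum_le_suminf) auto
    finally show ?thesis .
  qed simp
  then have "(\<integral>\<^sup>+x. g x \<partial>lborel) \<le> (\<integral>\<^sup>+x. (\<Sum>k. ennreal (c k) * indicator {x :: real ^ 'n. nvol x < t k} x) \<partial>lborel)"
    by (intro nn_integral_mono) auto
  also have "\<dots> = (\<Sum>k. ennreal (c k) * emeasure lborel {x :: real ^ 'n. nvol x < t k})"
    by (subst nn_integral_suminf) (simp_all add: nn_integral_cmult_indicator)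
  also have "\<dots> = (\<Sum>k. ennreal (A * unit_ball_vol (real CARD('n)) * (1 / 2) ^ k))"
  proof (rule arg_cong[where f = suminf], rule ext)
    fix k
    have "c k * (unit_ball_vol (real CARD('n)) * t k) = unit_ball_vol (real CARD('n)) * (c k * t k)"
      by (simp only: mult_ac)
    then have "c k * (unit_ball_vol (real CARD('n)) * t k) = A * unit_ball_vol (real CARD('n)) * (1 / 2) ^ k"
      unfolding s by (simp only: mult_ac)
    then show "ennreal (c k) * emeasure lborel {x :: real ^ 'n. nvol x < t k}
        = ennreal (A * unit_ball_vol (real CARD('n)) * (1 / 2) ^ k)"
      using c t by (simp only: emeasure_nvol_less flip: ennreal_mult')
  qed
  also have "\<dots> = ennreal (\<Sum>k. A * unit_ball_vol (real CARD('n)) * (1 / 2) ^ k)"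
    using A by (intro suminf_ennreal2) auto
  also have "(\<Sum>k. A * unit_ball_vol (real CARD('n)) * (1 / 2 :: real) ^ k) = 2 * A * unit_ball_vol (real CARD('n))"
    by (subst suminf_mult) (auto simp: suminf_geometric)
  finally show ?thesis .
qed

lemma ex_power_interval:
  fixes a u :: real
  assumes "1 < a" "1 \<le> u"
  shows "\<exists>k. a ^ k \<le> u \<and> u < a ^ Suc k"
proof -
  have ex: "\<exists>k. u < a ^ k"
    using assms(1) by (rule real_arch_pow)
  define k where "k = (LEAST k. u < a ^ k)"
  have k: "u < a ^ k"
    unfolding k_def using ex by (rule LeastI_ex)
  have "k \<noteq> 0"
    using k assms(2) by (metis not_less power_0)
  then obtain j where j: "k = Suc j"
    using not0_implies_Suc by blast
  have "\<not> u < a ^ j"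
    using not_less_Least[of j "\<lambda>k. u < a ^ k"] j unfolding k_def by simp
  then show ?thesis
    using k j by (auto simp: not_less)
qed

lemma sqrt_power4 [simp]: "sqrt (4 ^ k) = 2 ^ k"
  by (simp add: real_sqrt_power)

text \<open>The shells t / 4^(k+1) < \<open>nvol\<close> \<le> t / 4^k are used; base 4 because the
  square root turns it into 2. The radii \<open>2 * t / 4 ^ k\<close> are doubled so that the closed
  outer end of a shell falls strictly inside.\<close>

lemma nn_integral_inverse_sqrt_nvol:
  assumes t: "0 < t"
  shows "(\<integral>\<^sup>+x. ennreal (1 / sqrt (nvol x)) * indicator {x :: real ^ 'n. nvol x < t} x \<partial>lborel)
    \<le> ennreal (8 * sqrt t * unit_ball_vol (real CARD('n)))"
proof -
  have "(\<integral>\<^sup>+x. ennreal (1 / sqrt (nvol x)) * indicator {x :: real ^ 'n. nvol x < t} x \<partial>lborel)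
      \<le> ennreal (2 * (4 * sqrt t) * unit_ball_vol (real CARD('n)))"
  proof (rule nn_integral_le_radial_series)
    show "0 \<le> 2 * 2 ^ k / sqrt t" "0 < 2 * t / 4 ^ k" for k :: nat
      using t by auto
    show "2 * 2 ^ k / sqrt t * (2 * t / 4 ^ k) = 4 * sqrt t * (1 / 2) ^ k" for k :: nat
    proof -
      have "2 * 2 ^ k / s * (2 * (s * s) / (2 ^ k * 2 ^ k)) = 4 * s * (1 / 2) ^ k" if "0 < s" for s :: real
        using that by (simp add: field_simps power_one_over)
      from this[of "sqrt t"] show ?thesis
        using t by (simp flip: power_mult_distrib)
    qed
    fix x :: "real ^ 'n"
    assume "ennreal (1 / sqrt (nvol x)) * indicator {x. nvol x < t} x \<noteq> 0"
    then have x: "0 < nvol x" "nvol x < t"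
      by (auto simp: indicator_def nvol_def split: if_splits)
    then obtain k where k: "4 ^ k \<le> t / nvol x" "t / nvol x < 4 ^ Suc k"
      using ex_power_interval[of 4 "t / nvol x"] by (auto simp: divide_simps)
    have "sqrt (t / nvol x) \<le> sqrt (4 ^ Suc k)"
      using k(2) by (intro real_sqrt_le_mono) simp
    then have "1 / sqrt (nvol x) \<le> 2 * 2 ^ k / sqrt t"
      using x t unfolding sqrt_power4 by (simp add: real_sqrt_divide divide_simps mult.commute)
    moreover have "nvol x < 2 * t / 4 ^ k"
      using k(1) x t by (simp add: divide_simps mult.commute)
    ultimately show "\<exists>k. nvol x < 2 * t / 4 ^ k \<and>
        ennreal (1 / sqrt (nvol x)) * indicator {x. nvol x < t} x \<le> ennreal (2 * 2 ^ k / sqrt t)"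
      using x by (intro exI[of _ k]) (auto simp: indicator_def intro!: ennreal_leI)
  qed
  then show ?thesis by simp
qed

text \<open>The counterpart at infinity, with the shells t 4^k \<le> \<open>nvol\<close> < t
  4^(k+1). The two integrals together test the kernel against the weight
  \<open>1 / sqrt (nvol y)\<close>.\<close>

lemma nn_integral_nvol_tail:
  assumes t: "0 < t"
  shows "(\<integral>\<^sup>+x. ennreal (1 / (nvol x * sqrt (nvol x))) * indicator {x :: real ^ 'n. t \<le> nvol x} x \<partial>lborel)
    \<le> ennreal (8 / sqrt t * unit_ball_vol (real CARD('n)))"
proof -
  have "(\<integral>\<^sup>+x. ennreal (1 / (nvol x * sqrt (nvol x))) * indicator {x :: real ^ 'n. t \<le> nvol x} x \<partial>lborel)
      \<le> ennreal (2 * (4 / sqrt t) * unit_ball_vol (real CARD('n)))"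
  proof (rule nn_integral_le_radial_series)
    show "0 \<le> 1 / (t * 4 ^ k * (sqrt t * 2 ^ k))" "0 < t * 4 ^ Suc k" for k :: nat
      using t by auto
    show "1 / (t * 4 ^ k * (sqrt t * 2 ^ k)) * (t * 4 ^ Suc k) = 4 / sqrt t * (1 / 2) ^ k" for k :: nat
      using t by (simp add: field_simps power_one_over)
    fix x :: "real ^ 'n"
    assume "ennreal (1 / (nvol x * sqrt (nvol x))) * indicator {x. t \<le> nvol x} x \<noteq> 0"
    then have x: "t \<le> nvol x"
      by (auto simp: indicator_def split: if_splits)
    then obtain k where k: "4 ^ k \<le> nvol x / t" "nvol x / t < 4 ^ Suc k"
      using ex_power_interval[of 4 "nvol x / t"] t by (auto simp: divide_simps)
    have 1: "t * 4 ^ k \<le> nvol x"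
      using k(1) t by (simp add: field_simps)
    have "sqrt (t * 4 ^ k) \<le> sqrt (nvol x)"
      using 1 by (intro real_sqrt_le_mono) simp
    then have "1 / (nvol x * sqrt (nvol x)) \<le> 1 / (t * 4 ^ k * (sqrt t * 2 ^ k))"
      using 1 t x by (intro divide_left_mono mult_mono mult_pos_pos) (auto simp: real_sqrt_mult)
    moreover have "nvol x < t * 4 ^ Suc k"
      using k(2) t by (simp add: field_simps)
    ultimately show "\<exists>k. nvol x < t * 4 ^ Suc k \<and>
        ennreal (1 / (nvol x * sqrt (nvol x))) * indicator {x. t \<le> nvol x} x
          \<le> ennreal (1 / (t * 4 ^ k * (sqrt t * 2 ^ k)))"
      using x by (intro exI[of _ k]) (auto simp: indicator_def intro!: ennreal_leI)
  qed
  then show ?thesis by simp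
qed

section \<open>The Hardy operator\<close>

text \<open>For n = 1 on the half-line this is Hilbert's kernel 1 / (x + y). Its only singularity is
  at the origin of the product space, where division by zero gives the value 0.\<close>

definition hardy_kernel :: "real ^ 'n \<Rightarrow> real ^ 'n \<Rightarrow> real" where
  "hardy_kernel x y = 1 / (norm x + norm y) ^ CARD('n)"

lemma hardy_kernel_nonneg [simp]: "0 \<le> hardy_kernel x y"
  by (simp add: hardy_kernel_def)

lemma hardy_kernel_commute: "hardy_kernel x y = hardy_kernel y x"
  by (simp add: hardy_kernel_def add.commute)

lemma hardy_kernel_le:
  assumes "x \<noteq> 0"
  shows "hardy_kernel x y \<le> 1 / nvol x"
proof -
  have "0 < norm x"
    using assms by simp
  then show ?thesis
    unfolding hardy_kernel_def nvol_def
    by (intro divide_left_mono power_mono mult_pos_pos zero_less_power add_pos_nonneg) auto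
qed

lemma borel_measurable_hardy_kernel [measurable (raw)]:
  assumes [measurable]: "f \<in> borel_measurable M" "g \<in> borel_measurable M"
  shows "(\<lambda>x. hardy_kernel (f x) (g x)) \<in> borel_measurable M"
  unfolding hardy_kernel_def[abs_def] by measurable

lemma standard_kernel_hardy: "standard_kernel (hardy_kernel :: real ^ 'n \<Rightarrow> real ^ 'n \<Rightarrow> real)"
proof -
  define n where "n = CARD('n)"
  have n: "1 \<le> n" by (simp add: n_def Suc_le_eq)
  \<comment> \<open>Each of the two smoothness differences is bounded with the constant 2 n 2^n, and
    the definition of a standard kernel adds them.\<close>
  define C :: real where "C = 4 * real n * 2 ^ n"
  have C: "1 \<le> C"
    using n mult_mono[of 1 "4 * real n" 1 "2 ^ n"] by (simp add: C_def)
  have size: "\<bar>hardy_kernel x y\<bar> \<le> C / norm (x - y) ^ n" if "x \<noteq> y" for x y :: "real ^ 'n"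
  proof -
    have "hardy_kernel x y \<le> 1 / norm (x - y) ^ n"
    proof -
      have "0 < norm (x - y)"
        using that by simp
      then show ?thesis
        unfolding hardy_kernel_def n_def using norm_triangle_ineq4[of x y]
        by (intro divide_left_mono power_mono mult_pos_pos zero_less_power) linarith+
    qed
    also have "\<dots> \<le> C / norm (x - y) ^ n"
      using C by (intro divide_right_mono) auto
    finally show ?thesis by simp
  qed
  have smooth: "\<bar>hardy_kernel x y - hardy_kernel x' y\<bar> \<le> 2 * n * 2 ^ n * norm (x - x') / norm (x - y) ^ (n + 1)"
    if "2 * norm (x - x') < norm (x - y)" for x x' y :: "real ^ 'n"
  proof -
    define d where "d = norm (x - y)"
    define s where "s = norm x + norm y"
    define s' where "s' = norm x' + norm y"
    have d: "0 < d"
      using that norm_ge_zero[of "x - x'"] unfolding d_def by linarith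
    have s: "d \<le> s"
      unfolding d_def s_def by (rule norm_triangle_ineq4)
    have "d \<le> norm (x - x') + norm (x' - y)"
      unfolding d_def using norm_triangle_ineq[of "x - x'" "x' - y"] by simp
    moreover have "norm (x' - y) \<le> s'"
      unfolding s'_def by (rule norm_triangle_ineq4)
    ultimately have s': "d / 2 \<le> s'"
      using that by (simp add: d_def)
    have diff: "\<bar>s - s'\<bar> \<le> norm (x - x')"
      unfolding s_def s'_def using norm_triangle_ineq3[of x x'] by simp
    \<comment> \<open>Rescaling by d / 2, a lower bound for both s and s', moves the reciprocals
      into the unit interval. There the power map is Lipschitz with constant n, which gives
      smoothness of order \<delta> = 1.\<close>
    define z where "z = d / (2 * s)"
    define w where "w = d / (2 * s')"
    have zw: "\<bar>z\<bar> \<le> 1" "\<bar>w\<bar> \<le> 1"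
      using d s s' by (auto simp: z_def w_def)
    have "\<bar>z ^ n - w ^ n\<bar> \<le> n * \<bar>z - w\<bar>"
      using norm_power_diff[of z w n] zw by simp
    moreover have "\<bar>z - w\<bar> \<le> norm (x - x') / d"
    proof -
      have "z - w = d * (s' - s) / (2 * s * s')"
        using d s s' by (simp add: z_def w_def field_simps)
      then have "\<bar>z - w\<bar> = d * \<bar>s - s'\<bar> / (2 * s * s')"
        using d s s' by (simp add: abs_mult abs_minus_commute)
      also have "\<dots> \<le> d * norm (x - x') / (2 * d * (d / 2))"
        using d s s' diff by (intro frac_le mult_left_mono mult_mono mult_pos_pos mult_nonneg_nonneg) auto
      also have "\<dots> = norm (x - x') / d"
        using d by simp
      finally show ?thesis .
    qed
    ultimately have main: "\<bar>z ^ n - w ^ n\<bar> \<le> n * (norm (x - x') / d)"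
      by (meson mult_left_mono of_nat_0_le_iff order_trans)
    have "hardy_kernel x y - hardy_kernel x' y = (2 / d) ^ n * (z ^ n - w ^ n)"
    proof -
      have eq: "(2 / d) ^ n * (d / (2 * r)) ^ n = 1 / r ^ n" for r
        using d by (simp only: power_mult_distrib[symmetric]) (simp add: power_one_over)
      show ?thesis
        unfolding right_diff_distrib z_def w_def eq by (simp add: hardy_kernel_def s_def s'_def n_def)
    qed
    then have "\<bar>hardy_kernel x y - hardy_kernel x' y\<bar> = (2 / d) ^ n * \<bar>z ^ n - w ^ n\<bar>"
      using d by (simp add: abs_mult)
    also have "\<dots> \<le> (2 / d) ^ n * (n * (norm (x - x') / d))"
      using d main by (intro mult_left_mono) auto
    also have "\<dots> = n * 2 ^ n * norm (x - x') / d ^ (n + 1)"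
      using d by (simp add: power_divide mult_ac)
    also have "\<dots> \<le> 2 * n * 2 ^ n * norm (x - x') / d ^ (n + 1)"
      using d by (intro divide_right_mono mult_right_mono) auto
    finally show ?thesis by (simp add: d_def)
  qed
  have "\<bar>hardy_kernel x y - hardy_kernel x' y\<bar> + \<bar>hardy_kernel y x - hardy_kernel y x'\<bar>
      \<le> C * norm (x - x') powr 1 / norm (x - y) powr (real n + 1)"
    if "2 * norm (x - x') < norm (x - y)" for x x' y :: "real ^ 'n"
  proof -
    have "norm (x - y) powr (real n + 1) = norm (x - y) ^ (n + 1)"
      using powr_realpow'[of "norm (x - y)" "n + 1"] by (simp add: add.commute)
    then show ?thesis
      using smooth[OF that] by (simp add: hardy_kernel_commute[of y x] hardy_kernel_commute[of y x'] C_def)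
  qed
  with size show ?thesis
    unfolding standard_kernel_def n_def by (intro exI[of _ C] exI[of _ 1]) auto
qed

text \<open>The weight is reproduced up to a constant. The integral is split where
  \<open>nvol y\<close> equals \<open>nvol x\<close>: the kernel is at most 1 /
  \<open>nvol x\<close> inside and 1 / \<open>nvol y\<close> outside, and each piece contributes
  half of the 16.\<close>

lemma nn_integral_hardy_kernel_weight:
  fixes x :: "real ^ 'n"
  assumes x: "x \<noteq> 0"
  shows "(\<integral>\<^sup>+y. ennreal (hardy_kernel x y / sqrt (nvol y)) \<partial>lborel)
    \<le> ennreal (16 * unit_ball_vol (real CARD('n)) / sqrt (nvol x))"
proof -
  let ?V = "unit_ball_vol (real CARD('n))"
  let ?t = "nvol x"
  have t: "0 < ?t"
    using x by simp
  let ?f = "\<lambda>y :: real ^ 'n. ennreal (1 / sqrt (nvol y)) * indicator {y. nvol y < ?t} y"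
  let ?g = "\<lambda>y :: real ^ 'n. ennreal (1 / (nvol y * sqrt (nvol y))) * indicator {y. ?t \<le> nvol y} y"
  have "ennreal (hardy_kernel x y / sqrt (nvol y)) \<le> ennreal (1 / ?t) * ?f y + ?g y" for y
  proof (cases "nvol y < ?t")
    case True
    have "hardy_kernel x y / sqrt (nvol y) \<le> 1 / ?t / sqrt (nvol y)"
      by (intro divide_right_mono hardy_kernel_le x) simp
    then show ?thesis
      using True by (simp add: ennreal_leI flip: ennreal_mult')
  next
    case False
    then have "y \<noteq> 0"
      using t by auto
    then have "hardy_kernel x y / sqrt (nvol y) \<le> 1 / nvol y / sqrt (nvol y)"
      unfolding hardy_kernel_commute[of x y] by (intro divide_right_mono hardy_kernel_le) simp_all
    then show ?thesis
      using False by (simp add: ennreal_leI)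
  qed
  then have "(\<integral>\<^sup>+y. ennreal (hardy_kernel x y / sqrt (nvol y)) \<partial>lborel)
      \<le> (\<integral>\<^sup>+y. ennreal (1 / ?t) * ?f y + ?g y \<partial>lborel)"
    by (intro nn_integral_mono) auto
  also have "\<dots> = ennreal (1 / ?t) * (\<integral>\<^sup>+y. ?f y \<partial>lborel) + (\<integral>\<^sup>+y. ?g y \<partial>lborel)"
    by (subst nn_integral_add, simp, simp, subst nn_integral_cmult) auto
  also have "\<dots> \<le> ennreal (1 / ?t) * ennreal (8 * sqrt ?t * ?V) + ennreal (8 / sqrt ?t * ?V)"
    by (intro add_mono mult_left_mono nn_integral_inverse_sqrt_nvol nn_integral_nvol_tail t) auto
  also have "\<dots> = ennreal (1 / ?t * (8 * sqrt ?t * ?V) + 8 / sqrt ?t * ?V)"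
    by (simp flip: ennreal_mult')
  also have "1 / ?t * (8 * sqrt ?t * ?V) + 8 / sqrt ?t * ?V = 16 * ?V / sqrt ?t"
  proof -
    have "sqrt ?t / ?t = 1 / sqrt ?t"
      using t real_div_sqrt[of ?t] by (simp add: divide_simps)
    then have "1 / ?t * (8 * sqrt ?t * ?V) = 8 / sqrt ?t * ?V"
      by (metis (no_types, opaque_lifting) mult.commute mult.left_commute times_divide_eq_left times_divide_eq_right mult_1)
    then show ?thesis by simp
  qed
  finally show ?thesis .
qed

text \<open>Schur's test with the weight \<open>1 / sqrt (nvol y)\<close>.\<close>

lemma hardy_schur:
  fixes g :: "real ^ 'n \<Rightarrow> real"
  assumes [measurable]: "g \<in> borel_measurable borel"
  shows "(\<integral>\<^sup>+x. (\<integral>\<^sup>+y. ennreal (hardy_kernel x y * \<bar>g y\<bar>) \<partial>lborel)\<^sup>2 \<partial>lborel)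
    \<le> ennreal ((16 * unit_ball_vol (real CARD('n)))\<^sup>2) * (\<integral>\<^sup>+x. ennreal ((g x)\<^sup>2) \<partial>lborel)"
proof -
  let ?C = "16 * unit_ball_vol (real CARD('n))"
  have [measurable]: "g \<in> borel_measurable lborel"
    by simp
  have pt: "(\<integral>\<^sup>+y. ennreal (hardy_kernel x y * \<bar>g y\<bar>) \<partial>lborel)\<^sup>2
      \<le> (\<integral>\<^sup>+y. ennreal (?C / sqrt (nvol x)) * ennreal (hardy_kernel x y * (sqrt (nvol y) * (g y)\<^sup>2)) \<partial>lborel)"
    if x: "x \<noteq> 0" for x :: "real ^ 'n"
  proof -
    let ?u = "\<lambda>y. sqrt (hardy_kernel x y / sqrt (nvol y))"
    let ?v = "\<lambda>y. sqrt (hardy_kernel x y * sqrt (nvol y)) * \<bar>g y\<bar>"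
    \<comment> \<open>At y = 0 the factor \<open>?u\<close> is 0 by division by zero although the
      kernel is positive there, so the factorization holds only off this null point.\<close>
    have uv: "hardy_kernel x y * \<bar>g y\<bar> = ?u y * ?v y" if "y \<noteq> 0" for y
    proof -
      have "?u y * sqrt (hardy_kernel x y * sqrt (nvol y)) = sqrt (hardy_kernel x y * hardy_kernel x y)"
        unfolding real_sqrt_mult[symmetric] using that by simp
      then have "?u y * sqrt (hardy_kernel x y * sqrt (nvol y)) = hardy_kernel x y"
        by simp
      then show ?thesis
        by (metis mult.assoc)
    qed
    have "AE y in lborel. y \<noteq> (0 :: real ^ 'n)"
      by (rule AE_lborel_singleton)
    then have "(\<integral>\<^sup>+y. ennreal (hardy_kernel x y * \<bar>g y\<bar>) \<partial>lborel) = (\<integral>\<^sup>+y. ennreal (?u y) * ennreal (?v y) \<partial>lborel)"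
      by (intro nn_integral_cong_AE, elim eventually_mono) (subst uv, assumption, rule ennreal_mult', simp)
    then have "(\<integral>\<^sup>+y. ennreal (hardy_kernel x y * \<bar>g y\<bar>) \<partial>lborel)\<^sup>2
        \<le> (\<integral>\<^sup>+y. (ennreal (?u y))\<^sup>2 \<partial>lborel) * (\<integral>\<^sup>+y. (ennreal (?v y))\<^sup>2 \<partial>lborel)"
      by (simp only:) (rule Cauchy_Schwarz_nn_integral; measurable)
    also have "(\<integral>\<^sup>+y. (ennreal (?u y))\<^sup>2 \<partial>lborel) = (\<integral>\<^sup>+y. ennreal (hardy_kernel x y / sqrt (nvol y)) \<partial>lborel)"
      by (simp add: ennreal_power)
    also have "(\<integral>\<^sup>+y. (ennreal (?v y))\<^sup>2 \<partial>lborel) = (\<integral>\<^sup>+y. ennreal (hardy_kernel x y * (sqrt (nvol y) * (g y)\<^sup>2)) \<partial>lborel)"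
      by (simp add: ennreal_power power_mult_distrib mult.assoc)
    also have "(\<integral>\<^sup>+y. ennreal (hardy_kernel x y / sqrt (nvol y)) \<partial>lborel) * \<dots> \<le> ennreal (?C / sqrt (nvol x)) * \<dots>"
      by (intro mult_right_mono nn_integral_hardy_kernel_weight x) simp
    also have "\<dots> = (\<integral>\<^sup>+y. ennreal (?C / sqrt (nvol x)) * ennreal (hardy_kernel x y * (sqrt (nvol y) * (g y)\<^sup>2)) \<partial>lborel)"
      by (subst nn_integral_cmult) auto
    finally show ?thesis .
  qed
  have 0: "AE y in lborel. y \<noteq> (0 :: real ^ 'n)"
    by (rule AE_lborel_singleton)
  then have "(\<integral>\<^sup>+x. (\<integral>\<^sup>+y. ennreal (hardy_kernel x y * \<bar>g y\<bar>) \<partial>lborel)\<^sup>2 \<partial>lborel)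
      \<le> (\<integral>\<^sup>+x. (\<integral>\<^sup>+y. ennreal (?C / sqrt (nvol x)) * ennreal (hardy_kernel x y * (sqrt (nvol y) * (g y)\<^sup>2)) \<partial>lborel) \<partial>lborel)"
    by (intro nn_integral_mono_AE, elim eventually_mono) (rule pt)
  \<comment> \<open>After the exchange of integrals, symmetry of the kernel lets the same weight
    estimate be applied in the other variable; the powers of \<open>nvol y\<close> then
    cancel.\<close>
  also have "\<dots> = (\<integral>\<^sup>+y. (\<integral>\<^sup>+x. ennreal (?C / sqrt (nvol x)) * ennreal (hardy_kernel x y * (sqrt (nvol y) * (g y)\<^sup>2)) \<partial>lborel) \<partial>lborel)"
    by (rule lborel_pair.Fubini') measurable
  also have "\<dots> = (\<integral>\<^sup>+y. ennreal (?C * (sqrt (nvol y) * (g y)\<^sup>2)) * (\<integral>\<^sup>+x. ennreal (hardy_kernel y x / sqrt (nvol x)) \<partial>lborel) \<partial>lborel)"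
    by (subst nn_integral_cmult[symmetric])
      (auto intro!: nn_integral_cong simp: hardy_kernel_commute mult_ac simp flip: ennreal_mult)
  also have "\<dots> \<le> (\<integral>\<^sup>+y. ennreal (?C\<^sup>2) * ennreal ((g y)\<^sup>2) \<partial>lborel)"
  proof (rule nn_integral_mono_AE, rule eventually_mono[OF 0])
    fix y :: "real ^ 'n"
    assume y: "y \<noteq> 0"
    have "ennreal (?C * (sqrt (nvol y) * (g y)\<^sup>2)) * (\<integral>\<^sup>+x. ennreal (hardy_kernel y x / sqrt (nvol x)) \<partial>lborel)
        \<le> ennreal (?C * (sqrt (nvol y) * (g y)\<^sup>2)) * ennreal (?C / sqrt (nvol y))"
      by (intro mult_left_mono nn_integral_hardy_kernel_weight y) simp
    also have "\<dots> = ennreal (?C * (sqrt (nvol y) * (g y)\<^sup>2) * (?C / sqrt (nvol y)))"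
      by (rule ennreal_mult''[symmetric]) simp
    also have "?C * (sqrt (nvol y) * (g y)\<^sup>2) * (?C / sqrt (nvol y)) = ?C\<^sup>2 * (g y)\<^sup>2"
      using y by (simp add: power2_eq_square)
    also have "ennreal \<dots> = ennreal (?C\<^sup>2) * ennreal ((g y)\<^sup>2)"
      by (rule ennreal_mult) auto
    finally show "ennreal (?C * (sqrt (nvol y) * (g y)\<^sup>2)) * (\<integral>\<^sup>+x. ennreal (hardy_kernel y x / sqrt (nvol x)) \<partial>lborel)
        \<le> ennreal (?C\<^sup>2) * ennreal ((g y)\<^sup>2)" .
  qed
  also have "\<dots> = ennreal (?C\<^sup>2) * (\<integral>\<^sup>+x. ennreal ((g x)\<^sup>2) \<partial>lborel)"
    by (rule nn_integral_cmult) measurable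
  finally show ?thesis .
qed

text \<open>No principal value is involved: for f in \<open>L2\<close> the integral converges
  absolutely for almost every x, on and off the support. Hence the kernel representation holds by
  definition. Where the integral diverges the value is 0.\<close>

definition hardy_operator :: "(real ^ 'n \<Rightarrow> real) \<Rightarrow> real ^ 'n \<Rightarrow> real" where
  "hardy_operator f x = (\<integral>y. hardy_kernel x y * f y \<partial>lebesgue)"

lemma hardy_operator_L2:
  fixes f :: "real ^ 'n \<Rightarrow> real"
  assumes f: "f \<in> L2"
  shows "AE x in lebesgue. integrable lebesgue (\<lambda>y. hardy_kernel x y * f y)" (is ?int)
    and "hardy_operator f \<in> L2" (is ?L2)
    and "L2_norm (hardy_operator f) \<le> 16 * unit_ball_vol (real CARD('n)) * L2_norm f" (is ?bound)
proof -
  let ?C = "16 * unit_ball_vol (real CARD('n))"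
  have fm [measurable]: "f \<in> borel_measurable lebesgue" and f2: "integrable lebesgue (\<lambda>x. (f x)\<^sup>2)"
    using f by (auto simp: L2_def)
  \<comment> \<open>Schur's test uses Fubini on the product of Borel measures, so f is replaced by
    an almost everywhere equal Borel function and the results are carried back to the
    completion.\<close>
  obtain g where [measurable]: "g \<in> borel_measurable lborel" and fg: "AE x in lborel. f x = g x"
    using completion_ex_borel_measurable_real[OF fm] by blast
  have fg': "AE x in lebesgue. f x = g x"
    using fg by (rule AE_completion)
  have [measurable]: "hardy_kernel x \<in> borel_measurable lebesgue" for x :: "real ^ 'n"
    by (rule measurable_completion) simp
  have T: "hardy_operator f x = (\<integral>y. hardy_kernel x y * g y \<partial>lborel)" for x
  proof -
    have "hardy_operator f x = (\<integral>y. hardy_kernel x y * g y \<partial>lebesgue)"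
      unfolding hardy_operator_def
      by (rule integral_cong_AE) (use fg' in \<open>auto intro: measurable_completion\<close>)
    then show ?thesis
      by (simp add: integral_completion)
  qed
  have Tm [measurable]: "hardy_operator f \<in> borel_measurable lborel"
    unfolding T[abs_def] by measurable
  have norm_g: "(\<integral>\<^sup>+x. ennreal ((g x)\<^sup>2) \<partial>lborel) = ennreal (\<integral>x. (f x)\<^sup>2 \<partial>lebesgue)"
  proof -
    have "(\<integral>\<^sup>+x. ennreal ((g x)\<^sup>2) \<partial>lborel) = (\<integral>\<^sup>+x. ennreal ((f x)\<^sup>2) \<partial>lborel)"
      by (rule nn_integral_cong_AE) (use fg in auto)
    also have "\<dots> = (\<integral>\<^sup>+x. ennreal ((f x)\<^sup>2) \<partial>lebesgue)"
      by (simp add: nn_integral_completion)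
    also have "\<dots> = ennreal (\<integral>x. (f x)\<^sup>2 \<partial>lebesgue)"
      by (rule nn_integral_eq_integral[OF f2]) simp
    finally show ?thesis .
  qed
  let ?N = "\<lambda>x. \<integral>\<^sup>+y. ennreal (hardy_kernel x y * \<bar>g y\<bar>) \<partial>lborel"
  have schur: "(\<integral>\<^sup>+x. (?N x)\<^sup>2 \<partial>lborel) \<le> ennreal (?C\<^sup>2 * (\<integral>x. (f x)\<^sup>2 \<partial>lebesgue))"
    using hardy_schur[of g] by (simp add: norm_g flip: ennreal_mult')
  then have "AE x in lborel. (?N x)\<^sup>2 \<noteq> \<infinity>"
    by (intro nn_integral_PInf_AE) (measurable, auto simp: top_unique)
  then have int: "AE x in lborel. integrable lborel (\<lambda>y. hardy_kernel x y * g y)"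
  proof (rule eventually_mono)
    fix x
    assume "(?N x)\<^sup>2 \<noteq> \<infinity>"
    then have "?N x < \<infinity>"
      by (cases "?N x") (auto simp: power2_eq_square)
    then show "integrable lborel (\<lambda>y. hardy_kernel x y * g y)"
      by (intro integrableI_bounded) (auto simp: abs_mult)
  qed
  have "integrable lebesgue (\<lambda>y. hardy_kernel x y * f y)" if "integrable lborel (\<lambda>y. hardy_kernel x y * g y)" for x
  proof -
    have "integrable lebesgue (\<lambda>y. hardy_kernel x y * g y)"
      using that by (subst integrable_completion) auto
    then show ?thesis
      by (rule integrable_cong_AE_imp) (use fg' in \<open>auto intro: measurable_completion\<close>)
  qed
  then have "AE x in lborel. integrable lebesgue (\<lambda>y. hardy_kernel x y * f y)"
    using int by (auto elim: eventually_mono)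
  then show ?int
    by (rule AE_completion)
  have le: "ennreal ((hardy_operator f x)\<^sup>2) \<le> (?N x)\<^sup>2" if "integrable lborel (\<lambda>y. hardy_kernel x y * g y)" for x
  proof -
    have "ennreal (norm (hardy_operator f x)) \<le> ?N x"
      unfolding T using integral_norm_bound_ennreal[OF that] by (simp add: abs_mult)
    then have "(ennreal (norm (hardy_operator f x)))\<^sup>2 \<le> (?N x)\<^sup>2"
      by (rule power_mono) simp
    then show ?thesis
      by (simp add: ennreal_power)
  qed
  have "(\<integral>\<^sup>+x. ennreal ((hardy_operator f x)\<^sup>2) \<partial>lborel) \<le> (\<integral>\<^sup>+x. (?N x)\<^sup>2 \<partial>lborel)"
    by (rule nn_integral_mono_AE) (use int le in \<open>auto elim!: eventually_mono\<close>)
  then have fin: "(\<integral>\<^sup>+x. ennreal ((hardy_operator f x)\<^sup>2) \<partial>lborel) \<le> ennreal (?C\<^sup>2 * (\<integral>x. (f x)\<^sup>2 \<partial>lebesgue))"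
    using schur by (rule order_trans)
  have T2: "integrable lborel (\<lambda>x. (hardy_operator f x)\<^sup>2)"
    using fin by (intro integrableI_bounded) (auto intro: le_less_trans)
  then have T2': "integrable lebesgue (\<lambda>x. (hardy_operator f x)\<^sup>2)"
    by (subst integrable_completion) auto
  then show ?L2
    using measurable_completion[OF Tm] by (simp add: L2_def)
  have "ennreal (\<integral>x. (hardy_operator f x)\<^sup>2 \<partial>lebesgue) \<le> ennreal (?C\<^sup>2 * (\<integral>x. (f x)\<^sup>2 \<partial>lebesgue))"
    using fin nn_integral_eq_integral[OF T2'] by (simp add: nn_integral_completion)
  then have "(\<integral>x. (hardy_operator f x)\<^sup>2 \<partial>lebesgue) \<le> ?C\<^sup>2 * (\<integral>x. (f x)\<^sup>2 \<partial>lebesgue)"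
    by (subst (asm) ennreal_le_iff) (auto intro!: mult_nonneg_nonneg)
  then have "sqrt (\<integral>x. (hardy_operator f x)\<^sup>2 \<partial>lebesgue) \<le> sqrt (?C\<^sup>2 * (\<integral>x. (f x)\<^sup>2 \<partial>lebesgue))"
    by (rule real_sqrt_le_mono)
  then show ?bound
    by (simp add: L2_norm_def real_sqrt_mult)
qed

lemma calderon_zygmund_hardy: "calderon_zygmund (hardy_operator :: (real ^ 'n \<Rightarrow> real) \<Rightarrow> real ^ 'n \<Rightarrow> real)"
proof -
  have "AE x in lebesgue. hardy_operator (\<lambda>y. \<alpha> * f y + \<beta> * g y) x = \<alpha> * hardy_operator f x + \<beta> * hardy_operator g x"
    if "f \<in> L2" "g \<in> L2" for f g :: "real ^ 'n \<Rightarrow> real" and \<alpha> \<beta>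
    using hardy_operator_L2(1)[OF that(1)] hardy_operator_L2(1)[OF that(2)]
  proof eventually_elim
    case (elim x)
    have "hardy_operator (\<lambda>y. \<alpha> * f y + \<beta> * g y) x
        = (\<integral>y. \<alpha> * (hardy_kernel x y * f y) + \<beta> * (hardy_kernel x y * g y) \<partial>lebesgue)"
      unfolding hardy_operator_def by (simp add: algebra_simps)
    then show ?case
      using elim by (simp add: hardy_operator_def)
  qed
  moreover have "\<exists>C. \<forall>f\<in>L2. hardy_operator f \<in> L2 \<and> L2_norm (hardy_operator f) \<le> C * L2_norm (f :: real ^ 'n \<Rightarrow> real)"
    using hardy_operator_L2(2,3) by blast
  ultimately show ?thesis
    unfolding calderon_zygmund_def
    using standard_kernel_hardy by (auto simp: hardy_operator_def[abs_def])
qed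

section \<open>Logarithms and BMO\<close>

lemma cube_sets_borel [measurable, simp]: "cube (a :: real ^ 'n) l \<in> sets borel"
proof -
  have "Measurable.pred borel (\<lambda>x :: real ^ 'n. \<forall>i. a $ i \<le> x $ i \<and> x $ i < a $ i + l)"
    by measurable
  then show ?thesis
    by (simp add: cube_def pred_def)
qed

lemma cube_sets_lebesgue [measurable, simp]: "cube a l \<in> sets lebesgue"
  by (rule sets_completionI_sets) simp

lemma emeasure_cube:
  fixes a :: "real ^ 'n"
  assumes "0 \<le> l"
  shows "emeasure lborel (cube a l) = ennreal (l ^ CARD('n))"
proof -
  let ?u = "a + vec l"
  have eq: "(\<Prod>b\<in>Basis. (?u - a) \<bullet> b) = l ^ CARD('n)"
  proof -
    have "(\<Prod>b\<in>Basis. (?u - a) \<bullet> b) = (\<Prod>b\<in>(Basis :: (real ^ 'n) set). l)"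
      by (rule prod.cong) (auto simp: Basis_vec_def inner_axis)
    then show ?thesis by simp
  qed
  have le: "a \<bullet> b \<le> ?u \<bullet> b" if "b \<in> Basis" for b
    using that assms by (auto simp: Basis_vec_def inner_axis)
  have "box a ?u \<subseteq> cube a l" "cube a l \<subseteq> cbox a ?u"
    by (auto simp: cube_def mem_box_cart less_imp_le)
  then have "emeasure lborel (box a ?u) \<le> emeasure lborel (cube a l)"
      "emeasure lborel (cube a l) \<le> emeasure lborel (cbox a ?u)"
    by (auto intro!: emeasure_mono)
  then show ?thesis
    using emeasure_lborel_box[of a ?u] emeasure_lborel_cbox[of a ?u] le eq by simp
qed

lemma measure_cube:
  fixes a :: "real ^ 'n"
  assumes "0 \<le> l"
  shows "measure lborel (cube a l) = l ^ CARD('n)"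
  using emeasure_cube[OF assms, of a] assms by (simp add: measure_def)

lemma norm_diff_cube_le:
  fixes a :: "real ^ 'n"
  assumes "x \<in> cube a l" "y \<in> cube a l"
  shows "norm (x - y) \<le> real CARD('n) * l"
proof -
  have "norm (x - y) \<le> (\<Sum>i\<in>UNIV. \<bar>(x - y) $ i\<bar>)"
    by (rule norm_le_l1_cart)
  also have "\<dots> \<le> (\<Sum>i\<in>(UNIV :: 'n set). l)"
  proof (rule sum_mono)
    fix i :: 'n
    have "a $ i \<le> x $ i" "x $ i < a $ i + l" "a $ i \<le> y $ i" "y $ i < a $ i + l"
      using assms by (auto simp: cube_def)
    then show "\<bar>(x - y) $ i\<bar> \<le> l"
      by simp
  qed
  finally show ?thesis by simp
qed

lemma corner_in_cube: "0 < l \<Longrightarrow> a \<in> cube a l"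
  by (simp add: cube_def)

text \<open>The mean differs from c by at most the mean of |b - c|. Thus BMO may be tested with any
  convenient constant on each cube, at the price of a factor 2.\<close>

lemma mean_oscillation_le:
  fixes b :: "real ^ 'n \<Rightarrow> real"
  assumes Q: "Q \<in> sets lebesgue" "emeasure lebesgue Q < \<infinity>" "0 < measure lebesgue Q"
    and b: "set_integrable lebesgue Q b"
  shows "mean Q (\<lambda>x. \<bar>b x - mean Q b\<bar>) \<le> 2 * mean Q (\<lambda>x. \<bar>b x - c\<bar>)"
proof -
  have const: "set_integrable lebesgue Q (\<lambda>_. k)" for k :: real
    using Q by (simp add: set_integrable_def)
  have int: "set_integrable lebesgue Q (\<lambda>x. \<bar>b x - k\<bar>)" for k :: real
    using set_integrable_abs[OF set_integral_diff(1)[OF b const]] by simp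
  have mean_const: "mean Q (\<lambda>_. k) = k" for k
    using Q by (simp add: mean_def set_lebesgue_integral_def)
  have mean_diff: "mean Q b - c = mean Q (\<lambda>x. b x - c)"
    using set_integral_diff(2)[OF b const] mean_const[of c] by (simp add: mean_def diff_divide_distrib)
  have "\<bar>mean Q b - c\<bar> \<le> mean Q (\<lambda>x. \<bar>b x - c\<bar>)"
    unfolding mean_diff using set_integral_norm_bound[OF set_integral_diff(1)[OF b const], of c] Q(3)
    by (simp add: mean_def divide_right_mono abs_divide)
  moreover have "mean Q (\<lambda>x. \<bar>b x - mean Q b\<bar>) \<le> mean Q (\<lambda>x. \<bar>b x - c\<bar> + \<bar>mean Q b - c\<bar>)"
    unfolding mean_def[of Q "\<lambda>x. \<bar>b x - mean Q b\<bar>"] mean_def[of Q "\<lambda>x. \<bar>b x - c\<bar> + \<bar>mean Q b - c\<bar>"]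
    using Q(3) by (intro divide_right_mono set_integral_mono int set_integral_add(1) const) auto
  moreover have "mean Q (\<lambda>x. \<bar>b x - c\<bar> + \<bar>mean Q b - c\<bar>) = mean Q (\<lambda>x. \<bar>b x - c\<bar>) + \<bar>mean Q b - c\<bar>"
    using set_integral_add(2)[OF int const] mean_const[of "\<bar>mean Q b - c\<bar>"]
    by (simp add: mean_def add_divide_distrib)
  ultimately show ?thesis by simp
qed

text \<open>The logarithm is traded for a root already integrated: ln (R / |x|) \<le> ln (R^n /
  \<open>nvol x\<close>) = 2 ln sqrt (R^n / \<open>nvol x\<close>) \<le> 2 sqrt (R^n /
  \<open>nvol x\<close>). The 16 is twice the 8 of
  \<open>nn_integral_inverse_sqrt_nvol\<close>.\<close>

lemma nn_integral_ln_ratio: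
  assumes R: "0 < R"
  shows "(\<integral>\<^sup>+x. ennreal (ln R - ln (norm x)) * indicator {x :: real ^ 'n. x \<noteq> 0 \<and> norm x < R} x \<partial>lborel)
    \<le> ennreal (16 * unit_ball_vol (real CARD('n)) * R ^ CARD('n))"
proof -
  let ?V = "unit_ball_vol (real CARD('n))"
  let ?t = "R ^ CARD('n)"
  have t: "0 < ?t"
    using R by simp
  have "ennreal (ln R - ln (norm x)) * indicator {x. x \<noteq> 0 \<and> norm x < R} x
      \<le> ennreal (2 * sqrt ?t) * (ennreal (1 / sqrt (nvol x)) * indicator {x. nvol x < ?t} x)" for x :: "real ^ 'n"
  proof (cases "x \<noteq> 0 \<and> norm x < R")
    case True
    then have x: "0 < norm x" "norm x < R" by auto
    then have less: "nvol x < ?t"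
      unfolding nvol_def by (intro power_strict_mono) auto
    have "0 \<le> ln (R / norm x)"
      using x by simp
    then have "ln (R / norm x) \<le> real CARD('n) * ln (R / norm x)"
      by (intro mult_le_cancel_right1[THEN iffD2]) (auto simp: Suc_le_eq)
    also have "\<dots> = ln (?t / nvol x)"
      using x R by (simp add: nvol_def ln_div ln_realpow right_diff_distrib)
    also have "\<dots> = 2 * ln (sqrt (?t / nvol x))"
      using x t by (subst ln_sqrt) auto
    also have "\<dots> \<le> 2 * sqrt (?t / nvol x)"
      using x t ln_le_minus_one[of "sqrt (?t / nvol x)"] by simp
    finally have "ln R - ln (norm x) \<le> 2 * sqrt ?t * (1 / sqrt (nvol x))"
      using x R by (simp add: ln_div real_sqrt_divide)
    then show ?thesis
      using True less t by (simp add: ennreal_leI flip: ennreal_mult')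
  qed simp
  then have "(\<integral>\<^sup>+x. ennreal (ln R - ln (norm x)) * indicator {x :: real ^ 'n. x \<noteq> 0 \<and> norm x < R} x \<partial>lborel)
      \<le> (\<integral>\<^sup>+x. ennreal (2 * sqrt ?t) * (ennreal (1 / sqrt (nvol x)) * indicator {x :: real ^ 'n. nvol x < ?t} x) \<partial>lborel)"
    by (intro nn_integral_mono) auto
  also have "\<dots> = ennreal (2 * sqrt ?t) * (\<integral>\<^sup>+x. ennreal (1 / sqrt (nvol x)) * indicator {x :: real ^ 'n. nvol x < ?t} x \<partial>lborel)"
    by (rule nn_integral_cmult) measurable
  also have "\<dots> \<le> ennreal (2 * sqrt ?t) * ennreal (8 * sqrt ?t * ?V)"
    by (intro mult_left_mono nn_integral_inverse_sqrt_nvol t) simp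
  also have "\<dots> = ennreal (2 * sqrt ?t * (8 * sqrt ?t * ?V))"
    using t by (intro ennreal_mult'[symmetric]) simp
  also have "2 * sqrt ?t * (8 * sqrt ?t * ?V) = 16 * ?V * (sqrt ?t * sqrt ?t)"
    by (simp only: mult_ac)
  also have "sqrt ?t * sqrt ?t = ?t"
    using t by (intro real_sqrt_mult_self[THEN trans]) simp
  finally show ?thesis .
qed

lemma nn_integral_ln_norm_ball:
  assumes R: "0 < R"
  shows "(\<integral>\<^sup>+x. ennreal \<bar>ln (norm x) - ln R\<bar> * indicator (ball (0 :: real ^ 'n) R) x \<partial>lborel)
    \<le> ennreal (16 * unit_ball_vol (real CARD('n)) * R ^ CARD('n))"
proof -
  have ln_mono: "ln (norm x) \<le> ln R" if "x \<noteq> 0" "norm x < R" for x :: "real ^ 'n"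
    using that R by (subst ln_le_cancel_iff) auto
  have "AE x in lborel. x \<noteq> (0 :: real ^ 'n)"
    by (rule AE_lborel_singleton)
  then have "(\<integral>\<^sup>+x. ennreal \<bar>ln (norm x) - ln R\<bar> * indicator (ball (0 :: real ^ 'n) R) x \<partial>lborel)
      = (\<integral>\<^sup>+x. ennreal (ln R - ln (norm x)) * indicator {x :: real ^ 'n. x \<noteq> 0 \<and> norm x < R} x \<partial>lborel)"
    using ln_mono by (intro nn_integral_cong_AE, elim eventually_mono) (fastforce simp: indicator_def)
  then show ?thesis
    using nn_integral_ln_ratio[OF R] by simp
qed

lemma set_integrable_ln_norm:
  fixes A :: "(real ^ 'n) set"
  assumes A: "A \<in> sets lebesgue" "bounded A"
  shows "set_integrable lebesgue A (\<lambda>x. ln (norm x))"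
proof -
  obtain R where R: "0 < R" "A \<subseteq> ball 0 R"
    using bounded_subset_ballD[OF A(2)] by blast
  have "integrable lborel (\<lambda>x :: real ^ 'n. indicator (ball 0 R) x * (ln (norm x) - ln R))"
  proof (rule integrableI_bounded)
    have "(\<integral>\<^sup>+x. ennreal (norm (indicator (ball (0 :: real ^ 'n) R) x * (ln (norm x) - ln R))) \<partial>lborel)
        = (\<integral>\<^sup>+x. ennreal \<bar>ln (norm x) - ln R\<bar> * indicator (ball (0 :: real ^ 'n) R) x \<partial>lborel)"
      by (intro nn_integral_cong) (auto simp: indicator_def)
    also have "\<dots> < \<infinity>"
      using nn_integral_ln_norm_ball[OF R(1)] by (rule le_less_trans) simp
    finally show "(\<integral>\<^sup>+x. ennreal (norm (indicator (ball (0 :: real ^ 'n) R) x * (ln (norm x) - ln R))) \<partial>lborel) < \<infinity>" .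
  qed (intro borel_measurable_times borel_measurable_indicator, auto)
  then have "set_integrable lborel (ball 0 R) (\<lambda>x :: real ^ 'n. ln (norm x) - ln R)"
    by (simp add: set_integrable_def)
  moreover have "set_integrable lborel (ball 0 R) (\<lambda>x :: real ^ 'n. ln R)"
    using emeasure_lborel_ball_finite[of "0 :: real ^ 'n" R] by (simp add: set_integrable_def)
  ultimately have "set_integrable lborel (ball 0 R) (\<lambda>x :: real ^ 'n. ln (norm x) - ln R + ln R)"
    by (rule set_integral_add)
  then have "set_integrable lebesgue (ball 0 R) (\<lambda>x :: real ^ 'n. ln (norm x))"
    unfolding set_integrable_def by (subst integrable_completion) auto
  then show ?thesis
    by (rule set_integrable_subset) (use A R in auto)
qed

text \<open>Two regimes. A cube far from the origin compared with its side has all its points of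
  comparable norm, so the logarithm varies by at most ln 4. A cube near the origin lies in a ball of
  radius at most 4 n l, where the integral of the logarithmic singularity is bounded by a multiple
  of the volume.\<close>

lemma ln_norm_oscillation:
  fixes a :: "real ^ 'n"
  assumes l: "0 < l"
  shows "\<exists>c. mean (cube a l) (\<lambda>x. \<bar>ln (norm x) - c\<bar>)
    \<le> ln 4 + 16 * unit_ball_vol (real CARD('n)) * (4 * real CARD('n)) ^ CARD('n)"
proof -
  define n where "n = real CARD('n)"
  have n: "1 \<le> n" by (simp add: n_def Suc_le_eq)
  let ?V = "unit_ball_vol (real CARD('n))"
  let ?Q = "cube a l"
  \<comment> \<open>The constant subtracted is ln R. This R exceeds every norm on the cube, is at
    most 4 |x| for x in the cube in the far case, and is at most 4 n l in the near case.\<close>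
  define R where "R = norm a + 2 * n * l"
  have R: "0 < R"
    unfolding R_def using l n by (intro add_nonneg_pos mult_pos_pos) auto
  have near: "norm (x - a) \<le> n * l" if "x \<in> ?Q" for x
    using norm_diff_cube_le[OF that corner_in_cube[OF l]] by (simp add: n_def)
  have nl: "0 < n * l"
    using n l by simp
  have upper: "norm x < R" if "x \<in> ?Q" for x
    using near[OF that] norm_triangle_ineq[of "x - a" a] nl by (simp add: R_def)
  have int: "set_integrable lebesgue ?Q (\<lambda>x. \<bar>ln (norm x) - ln R\<bar>)"
  proof -
    have "bounded ?Q"
      using upper by (intro boundedI[of _ R]) (auto intro: less_imp_le)
    then have "set_integrable lebesgue ?Q (\<lambda>x. ln (norm x))"
      by (intro set_integrable_ln_norm) auto
    moreover have "set_integrable lebesgue ?Q (\<lambda>x. ln R)"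
      using l by (simp add: set_integrable_def emeasure_cube)
    ultimately show ?thesis
      using set_integrable_abs[OF set_integral_diff(1)] by blast
  qed
  have "set_lebesgue_integral lebesgue ?Q (\<lambda>x. \<bar>ln (norm x) - ln R\<bar>)
      \<le> (ln 4 + 16 * ?V * (4 * n) ^ CARD('n)) * l ^ CARD('n)"
  proof (cases "2 * n * l \<le> norm a")
    case True
    have "\<bar>ln (norm x) - ln R\<bar> \<le> ln 4" if "x \<in> ?Q" for x
    proof -
      have 1: "norm a \<le> norm x + n * l"
        using near[OF that] norm_triangle_sub[of a x] by (simp add: norm_minus_commute)
      then have 2: "0 < norm x" "R \<le> 4 * norm x"
        using True nl unfolding R_def by auto
      then have "ln R \<le> ln (4 * norm x)"
        using R by (subst ln_le_cancel_iff) auto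
      then have "ln R \<le> ln 4 + ln (norm x)"
        using 2 by (simp add: ln_mult)
      moreover have "ln (norm x) \<le> ln R"
        using upper[OF that] R 2 by simp
      ultimately show ?thesis by simp
    qed
    then have "set_lebesgue_integral lebesgue ?Q (\<lambda>x. \<bar>ln (norm x) - ln R\<bar>) \<le> set_lebesgue_integral lebesgue ?Q (\<lambda>x. ln 4)"
      using l by (intro set_integral_mono int) (auto simp: set_integrable_def emeasure_cube)
    also have "\<dots> = ln 4 * l ^ CARD('n)"
      using l by (simp add: set_lebesgue_integral_def measure_cube)
    also have "\<dots> \<le> (ln 4 + 16 * ?V * (4 * n) ^ CARD('n)) * l ^ CARD('n)"
      using l n by (intro mult_right_mono) auto
    finally show ?thesis .
  next
    case False
    have "ennreal (set_lebesgue_integral lebesgue ?Q (\<lambda>x. \<bar>ln (norm x) - ln R\<bar>))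
        = (\<integral>\<^sup>+x. ennreal (indicator ?Q x * \<bar>ln (norm x) - ln R\<bar>) \<partial>lebesgue)"
      using int unfolding set_lebesgue_integral_def set_integrable_def
      by (subst nn_integral_eq_integral) auto
    also have "\<dots> = (\<integral>\<^sup>+x. ennreal (indicator ?Q x * \<bar>ln (norm x) - ln R\<bar>) \<partial>lborel)"
      by (rule nn_integral_completion)
    also have "\<dots> \<le> (\<integral>\<^sup>+x. ennreal \<bar>ln (norm x) - ln R\<bar> * indicator (ball (0 :: real ^ 'n) R) x \<partial>lborel)"
      using upper by (intro nn_integral_mono) (auto simp: indicator_def)
    also have "\<dots> \<le> ennreal (16 * ?V * R ^ CARD('n))"
      by (rule nn_integral_ln_norm_ball[OF R])
    finally have "set_lebesgue_integral lebesgue ?Q (\<lambda>x. \<bar>ln (norm x) - ln R\<bar>) \<le> 16 * ?V * R ^ CARD('n)"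
      using R by (subst (asm) ennreal_le_iff) auto
    moreover have "R \<le> 4 * n * l"
      using False unfolding R_def by linarith
    then have "16 * ?V * R ^ CARD('n) \<le> 16 * ?V * (4 * n * l) ^ CARD('n)"
      using R by (intro mult_left_mono power_mono) auto
    moreover have "\<dots> \<le> (ln 4 + 16 * ?V * (4 * n) ^ CARD('n)) * l ^ CARD('n)"
      using l by (simp add: power_mult_distrib distrib_right mult.assoc)
    ultimately show ?thesis by linarith
  qed
  then have "mean ?Q (\<lambda>x. \<bar>ln (norm x) - ln R\<bar>) \<le> ln 4 + 16 * ?V * (4 * n) ^ CARD('n)"
    using l by (simp add: mean_def measure_cube divide_le_eq)
  then show ?thesis
    unfolding n_def by blast
qed

lemma ln_norm_BMO: "(\<lambda>x :: real ^ 'n. ln (norm x)) \<in> BMO"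
proof -
  define M where "M = ln 4 + 16 * unit_ball_vol (real CARD('n)) * (4 * real CARD('n)) ^ CARD('n)"
  let ?b = "\<lambda>x :: real ^ 'n. ln (norm x)"
  have "ennreal (mean Q (\<lambda>x. \<bar>?b x - mean Q ?b\<bar>)) \<le> ennreal (2 * M)" if "Q \<in> cubes" for Q
  proof -
    obtain a l where Q: "Q = cube a l" and l: "0 < l"
      using \<open>Q \<in> cubes\<close> by (auto simp: cubes_def)
    have "bounded (cube a l)"
      using norm_diff_cube_le[OF _ corner_in_cube[OF l], of _ a]
      by (intro boundedI[of _ "norm a + real CARD('n) * l"]) (meson add_left_mono norm_triangle_sub order_trans)
    then have "set_integrable lebesgue Q ?b"
      unfolding Q by (intro set_integrable_ln_norm) auto
    moreover obtain c where "mean Q (\<lambda>x. \<bar>?b x - c\<bar>) \<le> M"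
      using ln_norm_oscillation[OF l, of a] unfolding M_def Q by blast
    ultimately show ?thesis
      using mean_oscillation_le[of Q ?b c] l by (intro ennreal_leI) (auto simp: Q emeasure_cube measure_cube)
  qed
  then have "BMO_norm ?b \<le> ennreal (2 * M)"
    unfolding BMO_norm_def by (intro SUP_least) auto
  then have "BMO_norm ?b < \<infinity>"
    by (rule le_less_trans) simp
  moreover have "set_integrable lebesgue K ?b" if "compact K" for K
    using that by (intro set_integrable_ln_norm) (auto simp: compact_imp_bounded lmeasurable_compact fmeasurableD)
  ultimately show ?thesis
    by (simp add: BMO_def)
qed

section \<open>Lower bound for the commutator\<close>

text \<open>Half-open, so that consecutive dyadic annuli are disjoint.\<close>

definition annulus :: "real \<Rightarrow> real \<Rightarrow> (real ^ 'n) set" where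
  "annulus r s = {y. r \<le> norm y \<and> norm y < s}"

lemma annulus_eq: "annulus r s = ball 0 s - ball 0 r"
  by (auto simp: annulus_def)

lemma annulus_lmeasurable [simp]: "annulus r s \<in> lmeasurable"
  unfolding annulus_eq by (intro fmeasurable_Diff) auto

lemma annulus_sets [measurable, simp]: "annulus r s \<in> sets borel" "annulus r s \<in> sets lebesgue"
  unfolding annulus_eq by auto

lemma integrable_indicator_annulus: "integrable lebesgue (indicator (annulus r s) :: real ^ 'n \<Rightarrow> real)"
  using fmeasurableD2[OF annulus_lmeasurable, of r s]
  by (intro integrable_real_indicator) (auto simp: top.not_eq_extremum)

lemma bounded_annulus [simp]: "bounded (annulus r s)"
  unfolding annulus_eq by (rule bounded_subset[OF bounded_ball]) auto

lemma measure_annulus_ge: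
  assumes r: "0 < r"
  shows "unit_ball_vol (real CARD('n)) * r ^ CARD('n) \<le> measure lebesgue (annulus r (2 * r) :: (real ^ 'n) set)"
proof -
  have "measure lebesgue (annulus r (2 * r) :: (real ^ 'n) set)
      = measure lebesgue (ball (0 :: real ^ 'n) (2 * r)) - measure lebesgue (ball (0 :: real ^ 'n) r)"
    unfolding annulus_eq using r by (intro measurable_measure_Diff) auto
  also have "\<dots> = unit_ball_vol (real CARD('n)) * ((2 * r) ^ CARD('n) - r ^ CARD('n))"
    using r content_ball[of "2 * r" "0 :: real ^ 'n"] content_ball[of r "0 :: real ^ 'n"]
    by (simp add: right_diff_distrib)
  finally have eq: "measure lebesgue (annulus r (2 * r) :: (real ^ 'n) set)
      = unit_ball_vol (real CARD('n)) * ((2 * r) ^ CARD('n) - r ^ CARD('n))" .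
  have "(2 :: real) ^ 1 \<le> 2 ^ CARD('n)"
    by (rule power_increasing) (auto simp: Suc_le_eq)
  then have "2 * r ^ CARD('n) \<le> (2 * r) ^ CARD('n)"
    using r by (simp add: power_mult_distrib)
  then show ?thesis
    unfolding eq by (intro mult_left_mono) auto
qed

lemma indicator_annulus_Linfty_c: "(indicator (annulus r s) :: real ^ 'n \<Rightarrow> real) \<in> Linfty_c"
proof -
  have "bounded (supp (indicator (annulus r s) :: real ^ 'n \<Rightarrow> real))"
    unfolding supp_def by (rule bounded_closure) (simp add: indicator_def)
  then have "compact (supp (indicator (annulus r s) :: real ^ 'n \<Rightarrow> real))"
    unfolding supp_def compact_eq_bounded_closed by simp
  moreover have "AE x in lebesgue. \<bar>indicator (annulus r s) x :: real\<bar> \<le> 1"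
    by (auto simp: indicator_def)
  ultimately show ?thesis
    unfolding Linfty_c_def by auto
qed

text \<open>For x \<noteq> 0 the kernel is bounded in y by 1 / \<open>nvol x\<close>, so both terms
  of the commutator are absolutely convergent integrals and merge into one with the difference of
  logarithms. The formula holds at every such x, not merely almost everywhere.\<close>

lemma commutator_hardy_annulus:
  fixes x :: "real ^ 'n"
  assumes x: "x \<noteq> 0"
  shows "integrable lebesgue (\<lambda>y. hardy_kernel x y * (ln (norm y) - ln (norm x)) * indicator (annulus r s) y)" (is ?int)
    and "commutator (\<lambda>x. ln (norm x)) hardy_operator (indicator (annulus r s)) x
      = - (\<integral>y. hardy_kernel x y * (ln (norm y) - ln (norm x)) * indicator (annulus r s) y \<partial>lebesgue)" (is ?eq)
proof -
  have Km [measurable]: "hardy_kernel x \<in> borel_measurable lebesgue"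
    by (rule measurable_completion) simp
  have bnd: "integrable lebesgue (\<lambda>y. hardy_kernel x y * g y)" if g: "integrable lebesgue g" for g
  proof (rule Bochner_Integration.integrable_bound)
    show "integrable lebesgue (\<lambda>y. 1 / nvol x * g y)"
      using g by simp
    show "(\<lambda>y. hardy_kernel x y * g y) \<in> borel_measurable lebesgue"
      using g by measurable
    show "AE y in lebesgue. norm (hardy_kernel x y * g y) \<le> norm (1 / nvol x * g y)"
      using mult_right_mono[OF hardy_kernel_le[OF x] abs_ge_zero] by (auto simp: abs_mult)
  qed
  have 1: "integrable lebesgue (\<lambda>y. hardy_kernel x y * indicator (annulus r s) y)"
    by (rule bnd) (rule integrable_indicator_annulus)
  have "integrable lebesgue (\<lambda>y :: real ^ 'n. indicator (annulus r s) y * ln (norm y))"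
    using set_integrable_ln_norm[of "annulus r s"] by (simp add: set_integrable_def)
  then have "integrable lebesgue (\<lambda>y :: real ^ 'n. ln (norm y) * indicator (annulus r s) y)"
    by (simp add: mult.commute)
  from bnd[OF this] have 2: "integrable lebesgue (\<lambda>y. hardy_kernel x y * (ln (norm y) * indicator (annulus r s) y))" .
  have split: "hardy_kernel x y * (ln (norm y) - ln (norm x)) * indicator (annulus r s) y
      = hardy_kernel x y * (ln (norm y) * indicator (annulus r s) y) - ln (norm x) * (hardy_kernel x y * indicator (annulus r s) y)" for y
    by (simp add: algebra_simps)
  show ?int
    unfolding split using 1 2 by simp
  show ?eq
    unfolding split commutator_def hardy_operator_def using 1 2 by simp
qed

text \<open>At most one term survives at a given point, so a step function on disjoint shells can be
  compared with the integrand one shell at a time.\<close>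

lemma sum_disjoint_indicator_le:
  fixes g :: "nat \<Rightarrow> real"
  assumes disj: "\<And>i j. i < m \<Longrightarrow> j < m \<Longrightarrow> y \<in> A i \<Longrightarrow> y \<in> A j \<Longrightarrow> i = j"
    and le: "\<And>k. k < m \<Longrightarrow> y \<in> A k \<Longrightarrow> g k \<le> H" and H: "0 \<le> H"
  shows "(\<Sum>k<m. g k * indicator (A k) y) \<le> H"
proof (cases "\<exists>j<m. y \<in> A j")
  case True
  then obtain j where j: "j < m" "y \<in> A j" by blast
  have "(\<Sum>k<m. g k * indicator (A k) y) = (\<Sum>k<m. if k = j then g j else 0)"
  proof (rule sum.cong[OF refl])
    fix k
    assume "k \<in> {..<m}"
    then show "g k * indicator (A k) y = (if k = j then g j else 0)"
      using disj[of k j] j by (cases "y \<in> A k") auto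
  qed
  then show ?thesis
    using j le by simp
next
  case False
  then show ?thesis
    using H by (simp add: sum.neutral)
qed

text \<open>On the shell \<open>r k\<close> \<le> |y| < 2 \<open>r k\<close> with \<open>r k\<close>
  = 2^k 2^-m, the logarithms differ by at least k ln 2, the kernel is at least (4
  \<open>r k\<close>)^-n, and the volume is at least that of a ball of radius \<open>r k\<close>.
  The powers of \<open>r k\<close> cancel, leaving k times a constant; the integrand is nonnegative
  on the annulus, so the shells add up.\<close>

lemma commutator_lower_bound:
  fixes x :: "real ^ 'n"
  assumes x: "x \<noteq> 0" "norm x < (1 / 2) ^ m"
  shows "ln 2 * unit_ball_vol (real CARD('n)) / 4 ^ CARD('n) * (\<Sum>k<m. real k)
    \<le> \<bar>commutator (\<lambda>x. ln (norm x)) hardy_operator (indicator (annulus ((1 / 2) ^ m) 1)) x\<bar>"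
proof -
  let ?V = "unit_ball_vol (real CARD('n))"
  define \<epsilon> :: real where "\<epsilon> = (1 / 2) ^ m"
  define r where "r k = 2 ^ k * \<epsilon>" for k
  define g where "g k = real k * ln 2 / (4 * r k) ^ CARD('n)" for k
  let ?A = "\<lambda>k. annulus (r k) (2 * r k) :: (real ^ 'n) set"
  let ?H = "\<lambda>y. hardy_kernel x y * (ln (norm y) - ln (norm x)) * indicator (annulus \<epsilon> 1) y"
  have \<epsilon>: "0 < \<epsilon>" "norm x < \<epsilon>"
    using x by (auto simp: \<epsilon>_def)
  have r: "0 < r k" for k
    using \<epsilon> by (simp add: r_def)
  have nx: "0 < norm x"
    using x by simp
  have r_mono: "r i \<le> r j" if "i \<le> j" for i j
    using that \<epsilon> by (auto simp: r_def intro!: mult_right_mono power_increasing)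
  have pos: "0 \<le> ?H y" for y
  proof (cases "y \<in> annulus \<epsilon> 1")
    case True
    then have "ln (norm x) \<le> ln (norm y)"
      using \<epsilon> nx by (subst ln_le_cancel_iff) (simp_all add: annulus_def del: zero_less_norm_iff)
    then show ?thesis by simp
  qed simp
  have le: "(\<Sum>k<m. g k * indicator (?A k) y) \<le> ?H y" for y
  proof (rule sum_disjoint_indicator_le[OF _ _ pos])
    show "i = j" if "y \<in> ?A i" "y \<in> ?A j" for i j
    proof (rule ccontr)
      assume "i \<noteq> j"
      then consider "Suc i \<le> j" | "Suc j \<le> i" by linarith
      then show False
        using r_mono[of "Suc i" j] r_mono[of "Suc j" i] that by cases (auto simp: annulus_def r_def)
    qed
  next
    fix k
    assume k: "k < m" and y: "y \<in> ?A k"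
    have "2 * r k \<le> r m"
      using r_mono[of "Suc k" m] k by (simp add: r_def)
    also have "r m = 1"
      by (simp add: r_def \<epsilon>_def power_one_over)
    finally have mem: "y \<in> annulus \<epsilon> 1"
      using y r_mono[of 0 k] by (simp add: annulus_def r_def)
    have ny: "0 < norm y" "r k \<le> norm y"
      using y r[of k] by (auto simp: annulus_def)
    have "real k * ln 2 = ln (r k) - ln \<epsilon>"
      using \<epsilon> by (simp add: r_def ln_mult ln_realpow)
    also have "\<dots> \<le> ln (norm y) - ln (norm x)"
      using ny nx \<epsilon> r[of k] by (intro diff_mono) (simp_all)
    finally have 1: "real k * ln 2 \<le> ln (norm y) - ln (norm x)" .
    have "r 0 = \<epsilon>"
      by (simp add: r_def)
    then have "norm x < r k"
      using \<epsilon> r_mono[of 0 k] by linarith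
    then have "norm x + norm y \<le> 4 * r k"
      using y r[of k] unfolding annulus_def mem_Collect_eq by linarith
    then have 2: "1 / (4 * r k) ^ CARD('n) \<le> hardy_kernel x y"
      unfolding hardy_kernel_def using nx r[of k] by (intro divide_left_mono power_mono mult_pos_pos zero_less_power add_pos_nonneg nx) auto
    have "1 / (4 * r k) ^ CARD('n) * (real k * ln 2) \<le> hardy_kernel x y * (ln (norm y) - ln (norm x))"
      using 1 2 by (intro mult_mono) auto
    then show "g k \<le> ?H y"
      using mem by (simp add: g_def mult.commute)
  qed
  have int: "integrable lebesgue (\<lambda>y. g k * indicator (?A k) y)" for k
    by (intro integrable_mult_right integrable_indicator_annulus)
  have "ln 2 * ?V / 4 ^ CARD('n) * (\<Sum>k<m. real k) = (\<Sum>k<m. g k * (?V * r k ^ CARD('n)))"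
    unfolding sum_distrib_left using r by (intro sum.cong) (auto simp: g_def power_mult_distrib less_imp_neq[THEN not_sym])
  also have "\<dots> \<le> (\<Sum>k<m. g k * measure lebesgue (?A k))"
    using r by (intro sum_mono mult_left_mono measure_annulus_ge) (auto simp: g_def less_imp_le)
  also have "\<dots> = (\<Sum>k<m. \<integral>y. g k * indicator (?A k) y \<partial>lebesgue)"
    by simp
  also have "\<dots> = (\<integral>y. (\<Sum>k<m. g k * indicator (?A k) y) \<partial>lebesgue)"
    using int by (intro Bochner_Integration.integral_sum[symmetric]) auto
  also have "\<dots> \<le> (\<integral>y. ?H y \<partial>lebesgue)"
    by (intro integral_mono le Bochner_Integration.integrable_sum int commutator_hardy_annulus(1) x)
  finally have "ln 2 * ?V / 4 ^ CARD('n) * (\<Sum>k<m. real k) \<le> (\<integral>y. ?H y \<partial>lebesgue)" .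
  then show ?thesis
    using commutator_hardy_annulus(2)[OF x(1), of \<epsilon> 1] by (simp add: \<epsilon>_def)
qed

section \<open>Sparse sums\<close>

definition side :: "(real ^ 'n) set \<Rightarrow> real" where
  "side Q = (THE l. 0 < l \<and> (\<exists>a. Q = cube a l))"

text \<open>A half-open cube contains its least corner, so each of the two corners lies
  coordinatewise below the other; equal volumes then give equal sides. This makes
  \<open>side\<close> well defined on \<open>cubes\<close>.\<close>

lemma cube_eqD:
  fixes a b :: "real ^ 'n"
  assumes l: "0 < l" and k: "0 < k" and eq: "cube a l = cube b k"
  shows "a = b" and "l = k"
proof -
  have "a \<in> cube b k" "b \<in> cube a l"
    using corner_in_cube[OF l, of a] corner_in_cube[OF k, of b] eq by auto
  then show "a = b"
    by (auto simp: cube_def vec_eq_iff intro: antisym)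
  have "l ^ CARD('n) = k ^ CARD('n)"
    using measure_cube[of l a] measure_cube[of k b] l k eq by simp
  then show "l = k"
    using l k power_eq_imp_eq_base[of l "CARD('n)" k] by simp
qed

lemma side_cube [simp]: "0 < l \<Longrightarrow> side (cube a l) = l"
  unfolding side_def by (rule the_equality) (auto dest: cube_eqD(2))

lemma cubesE:
  assumes "Q \<in> cubes"
  obtains a where "Q = cube a (side Q)" "0 < side Q"
  using assms by (auto simp: cubes_def)

lemma cubes_sets_lebesgue: "Q \<in> cubes \<Longrightarrow> Q \<in> sets lebesgue"
  by (auto simp: cubes_def)

lemma emeasure_cubes:
  fixes Q :: "(real ^ 'n) set"
  assumes "Q \<in> cubes"
  shows "emeasure lebesgue Q = ennreal (side Q ^ CARD('n))"
  using assms by (auto simp: cubes_def emeasure_cube)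

text \<open>Iterated bisection is turned into integer coordinates, so that cubes of one generation
  can be compared by arithmetic on their indices.\<close>

lemma dyadic_subcubes_grid:
  fixes a :: "real ^ 'n"
  assumes "P \<in> dyadic_subcubes (cube a l)" and l: "0 < l"
  shows "\<exists>k (m :: 'n \<Rightarrow> int). P = cube (\<chi> i. a $ i + l / 2 ^ k * m i) (l / 2 ^ k)"
  using assms(1)
proof induction
  case self
  show ?case
    by (rule exI[of _ 0], rule exI[of _ "\<lambda>_. 0"]) simp
next
  case (child P P')
  then obtain k and m :: "'n \<Rightarrow> int" where P: "P = cube (\<chi> i. a $ i + l / 2 ^ k * m i) (l / 2 ^ k)"
    by blast
  obtain a1 a' l1 where P': "P' = cube a' (l1 / 2)" "0 < l1" "P = cube a1 l1"
      and a': "\<And>i. a' $ i \<in> {a1 $ i, a1 $ i + l1 / 2}"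
    using child(2) by (auto simp: dyadic_children_def)
  have eq: "a1 = (\<chi> i. a $ i + l / 2 ^ k * m i)" "l1 = l / 2 ^ k"
    using cube_eqD[of l1 "l / 2 ^ k" a1] P P' l by auto
  \<comment> \<open>Bisection doubles the index in each coordinate and adds 1 exactly when the upper
    half is taken.\<close>
  define m' where "m' i = (if a' $ i = a1 $ i then 2 * m i else 2 * m i + 1)" for i
  have "a' $ i = a $ i + l / 2 ^ Suc k * m' i" for i
    using a'[of i] by (auto simp: m'_def eq field_simps)
  then have "a' = (\<chi> i. a $ i + l / 2 ^ Suc k * m' i)"
    by (simp add: vec_eq_iff)
  moreover have "l1 / 2 = l / 2 ^ Suc k"
    by (simp add: eq)
  ultimately have "P' = cube (\<chi> i. a $ i + l / 2 ^ Suc k * m' i) (l / 2 ^ Suc k)"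
    using P'(1) by (simp only:)
  then show ?case
    by blast
qed

text \<open>By (DL-2) both cubes descend from one cube, so their sides are l / 2^k and l / 2^j;
  sides within a factor less than 2 force k = j, and grid cells of one generation sharing a point
  have the same indices. The hypothesis compares sides only up to a factor because l is arbitrary:
  the sides need not be powers of 2, and scales are later obtained by rounding.\<close>

lemma dyadic_lattice_same_scale:
  assumes D: "dyadic_lattice D" "P \<in> D" "Q \<in> D" and x: "x \<in> P" "x \<in> Q"
    and side: "side P < 2 * side Q" "side Q < 2 * side P"
  shows "P = Q"
proof -
  obtain R where R: "R \<in> D" "P \<in> dyadic_subcubes R" "Q \<in> dyadic_subcubes R"
    using D unfolding dyadic_lattice_def by blast
  then have "R \<in> cubes"
    using D(1) by (auto simp: dyadic_lattice_def)
  then obtain a l where Rc: "R = cube a l" and l: "0 < l"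
    by (auto simp: cubes_def)
  obtain k and m :: "'a \<Rightarrow> int" where P: "P = cube (\<chi> i. a $ i + l / 2 ^ k * m i) (l / 2 ^ k)"
    using dyadic_subcubes_grid[OF _ l] R(2) Rc by blast
  obtain j and m' :: "'a \<Rightarrow> int" where Q: "Q = cube (\<chi> i. a $ i + l / 2 ^ j * m' i) (l / 2 ^ j)"
    using dyadic_subcubes_grid[OF _ l] R(3) Rc by blast
  have "l / 2 ^ k < 2 * (l / 2 ^ j)" "l / 2 ^ j < 2 * (l / 2 ^ k)"
    using side l by (simp_all add: P Q)
  then have "(2 :: real) ^ j < 2 ^ Suc k" "(2 :: real) ^ k < 2 ^ Suc j"
    using l by (simp_all add: field_simps)
  then have kj: "k = j"
    by (simp only: power_strict_increasing_iff) 
  define d where "d = l / 2 ^ j"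
  have d: "0 < d" using l by (simp add: d_def)
  have "m i = m' i" for i
  proof -
    have "a $ i + d * m i \<le> x $ i" "x $ i < a $ i + d * m i + d"
         "a $ i + d * m' i \<le> x $ i" "x $ i < a $ i + d * m' i + d"
      using x unfolding P Q cube_def kj d_def by auto
    then have "d * m i < d * (m' i + 1)" "d * m' i < d * (m i + 1)"
      by (simp_all add: distrib_left)
    then have "real_of_int (m i) < m' i + 1" "real_of_int (m' i) < m i + 1"
      using d by (simp_all only: mult_less_cancel_left_pos)
    then show ?thesis by linarith
  qed
  then show ?thesis
    by (simp add: P Q kj)
qed

text \<open>A cube is determined by one of its points in a countable dense set together with the
  integer part of the logarithm of its side. Countability is what permits measurability and termwise
  integration of sums over cubes.\<close>

lemma dyadic_lattice_countable:
  fixes D :: "(real ^ 'n) set set"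
  assumes D: "dyadic_lattice D"
  shows "countable D"
proof -
  obtain A :: "(real ^ 'n) set" where A: "countable A" "\<And>X. open X \<Longrightarrow> X \<noteq> {} \<Longrightarrow> \<exists>d\<in>A. d \<in> X"
    using countable_dense_exists by blast
  have cubes: "D \<subseteq> cubes"
    using D by (simp add: dyadic_lattice_def)
  have "\<exists>d\<in>A. d \<in> Q" if "Q \<in> D" for Q
  proof -
    obtain a where Q: "Q = cube a (side Q)" "0 < side Q"
      using \<open>Q \<in> D\<close> cubes by (meson cubesE subsetD)
    have "a + vec (side Q / 2) \<in> box a (a + vec (side Q))"
      using Q(2) by (simp add: mem_box_cart)
    then obtain d where "d \<in> A" "d \<in> box a (a + vec (side Q))"
      using A(2)[OF open_box] by blast
    moreover have "box a (a + vec (side Q)) \<subseteq> cube a (side Q)"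
      by (auto simp: cube_def mem_box_cart less_imp_le)
    ultimately show ?thesis
      using Q(1) by auto
  qed
  then obtain p where p: "\<And>Q. Q \<in> D \<Longrightarrow> p Q \<in> A \<and> p Q \<in> Q"
    by metis
  define s where "s Q = \<lfloor>log 2 (side Q)\<rfloor>" for Q :: "(real ^ 'n) set"
  have "inj_on (\<lambda>Q. (p Q, s Q)) D"
  proof (rule inj_onI)
    fix P Q
    assume PQ: "P \<in> D" "Q \<in> D" and eq: "(p P, s P) = (p Q, s Q)"
    have pos: "0 < side P" "0 < side Q"
      using PQ cubes by (meson cubesE subsetD)+
    have "log 2 (side P) < log 2 (2 * side Q)" "log 2 (side Q) < log 2 (2 * side P)"
      using pos eq unfolding s_def by (simp_all add: log_mult) linarith+
    then have "side P < 2 * side Q" "side Q < 2 * side P"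
      using pos by simp_all
    then show "P = Q"
      using dyadic_lattice_same_scale[OF D PQ, of "p P"] p[OF PQ(1)] p[OF PQ(2)] eq by auto
  qed
  moreover have "(\<lambda>Q. (p Q, s Q)) ` D \<subseteq> A \<times> UNIV"
    using p by auto
  ultimately show ?thesis
    using A(1) by (meson countable_SIGMA countable_image_inj_on countable_subset countableI_type)
qed

section \<open>Luxemburg averages of indicators\<close>

lemma Phi_le:
  assumes "0 \<le> u"
  shows "0 \<le> Phi u" and "Phi u \<le> u * (1 + u)"
proof -
  have e: "1 \<le> exp (1 :: real)"
    by simp
  then have "0 \<le> ln (exp 1 + u)"
    using assms by (intro ln_ge_zero) linarith
  then show "0 \<le> Phi u"
    unfolding Phi_def using assms by simp
  \<comment> \<open>The logarithm is replaced by the linear bound 1 + u. The resulting quadratic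
    bound on \<open>Phi\<close> loses the sharp decay of the averages but keeps a square root,
    enough for a geometric series.\<close>
  have "exp 1 + u \<le> exp 1 * (1 + u)"
    using mult_right_mono[OF e assms] by (simp add: distrib_left)
  also have "\<dots> \<le> exp 1 * exp u"
    by (intro mult_left_mono exp_ge_add_one_self) simp
  finally have "exp 1 + u \<le> exp (1 + u)"
    by (simp add: exp_add)
  then have "ln (exp 1 + u) \<le> 1 + u"
    using ln_mono[of "exp 1 + u" "exp (1 + u)"] assms by (simp add: add_pos_nonneg)
  then show "Phi u \<le> u * (1 + u)"
    unfolding Phi_def using assms by (rule mult_left_mono)
qed

text \<open>Since \<open>Phi 0\<close> = 0, the integral in the Luxemburg norm is
  \<open>Phi (1 / t)\<close> times the measure of the intersection, and the hypothesis says exactly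
  that t is admissible.\<close>

lemma LlogL_average_indicator_le:
  fixes Q :: "(real ^ 'n) set"
  assumes A [measurable]: "A \<in> sets lebesgue" and Q: "Q \<in> cubes" and t: "0 < t"
    and le: "ennreal (Phi (1 / t)) * emeasure lebesgue (A \<inter> Q) \<le> emeasure lebesgue Q"
  shows "LlogL_average (indicator A) Q \<le> ennreal t"
proof -
  have [measurable]: "Q \<in> sets lebesgue"
    using Q by (rule cubes_sets_lebesgue)
  have "0 < side Q"
    using Q by (auto elim: cubesE)
  then have pos: "0 < emeasure lebesgue Q"
    using emeasure_cubes[OF Q] by simp
  have "(\<integral>\<^sup>+x\<in>Q. ennreal (Phi (\<bar>indicator A x\<bar> / t)) \<partial>lebesgue)
      = (\<integral>\<^sup>+x. ennreal (Phi (1 / t)) * indicator (A \<inter> Q) x \<partial>lebesgue)"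
    by (intro nn_integral_cong) (auto simp: indicator_def Phi_def)
  also have "\<dots> = ennreal (Phi (1 / t)) * emeasure lebesgue (A \<inter> Q)"
    by (rule nn_integral_cmult_indicator) simp
  also have "\<dots> \<le> emeasure lebesgue Q * 1"
    using le by simp
  finally have "(\<integral>\<^sup>+x\<in>Q. ennreal (Phi (\<bar>indicator A x\<bar> / t)) \<partial>lebesgue) / emeasure lebesgue Q \<le> 1"
    using pos by (intro divide_le_posI_ennreal)
  then show ?thesis
    unfolding LlogL_average_def using t by (intro Inf_lower) auto
qed

lemma LlogL_average_indicator_le_2:
  fixes Q :: "(real ^ 'n) set"
  assumes A: "A \<in> sets lebesgue" and Q: "Q \<in> cubes"
  shows "LlogL_average (indicator A) Q \<le> ennreal 2"
proof (rule LlogL_average_indicator_le[OF A Q])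
  have "Phi (1 / 2) \<le> 1"
    using Phi_le(2)[of "1 / 2"] by simp
  then have "ennreal (Phi (1 / 2)) * emeasure lebesgue (A \<inter> Q) \<le> 1 * emeasure lebesgue Q"
    using Q by (intro mult_mono emeasure_mono) (auto simp: cubes_def ennreal_le_1)
  then show "ennreal (Phi (1 / 2)) * emeasure lebesgue (A \<inter> Q) \<le> emeasure lebesgue Q"
    by simp
qed simp

text \<open>With |Q| = q \<ge> 2V, the choice t = sqrt (2V / q) \<le> 1 gives
  \<open>Phi (1 / t)\<close> \<le> 2 / t^2 = q / V, so t is admissible; and q \<ge>
  \<open>side Q\<close> \<ge> 2^j in every dimension. If q < 2V, the uniform bound 2 suffices: the 8
  makes the right-hand side at least 2 in that case.\<close>

lemma LlogL_average_indicator_decay: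
  fixes Q :: "(real ^ 'n) set"
  assumes A: "A \<in> sets lebesgue" "emeasure lebesgue A \<le> ennreal V" and V: "0 < V"
    and Q: "Q \<in> cubes" and j: "2 ^ j \<le> side Q"
  shows "LlogL_average (indicator A) Q \<le> ennreal (sqrt (8 * V) * sqrt (1 / 2) ^ j)"
proof -
  have "0 < side Q"
    using Q by (auto elim: cubesE)
  define q where "q = side Q ^ CARD('n)"
  have q: "emeasure lebesgue Q = ennreal q" "0 < q"
    using \<open>0 < side Q\<close> emeasure_cubes[OF Q] by (auto simp: q_def)
  have "(1 :: real) \<le> 2 ^ j"
    by simp
  then have "1 \<le> side Q"
    using j by linarith
  then have "side Q ^ 1 \<le> q"
    unfolding q_def by (intro power_increasing) (auto simp: Suc_le_eq)
  then have jq: "2 ^ j \<le> q"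
    using j by simp
  have eq: "sqrt (8 * V) * sqrt (1 / 2) ^ j = sqrt (8 * V / 2 ^ j)"
  proof -
    have "8 * V * (1 / 2) ^ j = 8 * V / 2 ^ j"
      by (simp add: power_one_over)
    then show ?thesis
      by (metis real_sqrt_mult real_sqrt_power)
  qed
  show ?thesis
  proof (cases "2 * V \<le> q")
    case True
    define t where "t = sqrt (2 * V / q)"
    have t: "0 < t" "t \<le> 1" "t * t = 2 * V / q"
      using V q True by (auto simp: t_def)
    have "Phi (1 / t) \<le> 1 / t * (1 + 1 / t)"
      using t by (intro Phi_le) simp
    also have "\<dots> \<le> 1 / t * (1 / t + 1 / t)"
      using t by (intro mult_left_mono add_mono) auto
    also have "\<dots> = 2 / (t * t)"
      by simp
    also have "\<dots> = q / V"
      using t q V by simp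
    finally have "Phi (1 / t) * V \<le> q"
      using V by (simp add: pos_le_divide_eq)
    then have "ennreal (Phi (1 / t)) * ennreal V \<le> emeasure lebesgue Q"
      using Phi_le(1)[of "1 / t"] t V q by (simp add: ennreal_leI flip: ennreal_mult)
    moreover have "ennreal (Phi (1 / t)) * emeasure lebesgue (A \<inter> Q) \<le> ennreal (Phi (1 / t)) * ennreal V"
      using A by (intro mult_left_mono order_trans[OF emeasure_mono A(2)]) auto
    ultimately have "LlogL_average (indicator A) Q \<le> ennreal t"
      using t by (intro LlogL_average_indicator_le A Q) auto
    also have "t \<le> sqrt (8 * V / 2 ^ j)"
      unfolding t_def using V jq q by (intro real_sqrt_le_mono frac_le) auto
    finally show ?thesis
      by (simp add: eq ennreal_leI)
  next
    case False
    then have "2 ^ j \<le> 2 * V"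
      using jq by simp
    then have "4 \<le> 8 * V / 2 ^ j"
      by (simp add: field_simps)
    then have "sqrt 4 \<le> sqrt (8 * V / 2 ^ j)"
      by (rule real_sqrt_le_mono)
    then have "2 \<le> sqrt (8 * V) * sqrt (1 / 2) ^ j"
      by (simp add: eq)
    then show ?thesis
      using LlogL_average_indicator_le_2[OF A(1) Q] by (meson ennreal_leI order_trans)
  qed
qed

text \<open>The cubes of a lattice containing \<open>x\<close> have at most one member per dyadic scale; the scales
  between \<open>1 / 2 ^ m\<close> and \<open>1\<close> contribute at most \<open>2\<close> each, the larger ones a geometric series.\<close>

lemma large_cubes_sum:
  fixes D :: "(real ^ 'n) set set"
  assumes D: "dyadic_lattice D"
    and A: "A \<in> sets lebesgue" "emeasure lebesgue A \<le> ennreal V" and V: "0 < V"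
    and F: "finite F" "F \<subseteq> D" "\<And>Q. Q \<in> F \<Longrightarrow> x \<in> Q" "\<And>Q. Q \<in> F \<Longrightarrow> (1 / 2) ^ m \<le> side Q"
  shows "(\<Sum>Q\<in>F. LlogL_average (indicator A) Q) \<le> ennreal (2 * real m + sqrt (8 * V) / (1 - sqrt (1 / 2)))"
proof -
  let ?q = "sqrt (1 / 2)"
  have q: "0 < ?q" "?q < 1" by auto
  \<comment> \<open>Scales are counted upward from 2^-m: index k stands for sides in [2^(k-m),
    2^(k-m+1)). The indices k < m are the scales below 1, and the decay starts at k = m.\<close>
  define c where "c k = (if k < m then 2 else sqrt (8 * V) * ?q ^ (k - m))" for k
  have c: "0 \<le> c k" for k
    using V by (simp add: c_def)
  have cubes: "F \<subseteq> cubes"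
    using D F by (auto simp: dyadic_lattice_def)
  have "\<exists>k. 2 ^ k \<le> 2 ^ m * side Q \<and> 2 ^ m * side Q < 2 ^ Suc k" if "Q \<in> F" for Q
  proof (rule ex_power_interval)
    show "1 < (2 :: real)"
      by simp
    show "1 \<le> 2 ^ m * side Q"
      using F(4)[OF that] by (simp add: field_simps power_one_over)
  qed
  then obtain s where s: "\<And>Q. Q \<in> F \<Longrightarrow> 2 ^ s Q \<le> 2 ^ m * side Q \<and> 2 ^ m * side Q < 2 ^ Suc (s Q)"
    by metis
  have inj: "inj_on s F"
  proof (rule inj_onI)
    fix P Q
    assume PQ: "P \<in> F" "Q \<in> F" and eq: "s P = s Q"
    have "2 ^ m * side P < 2 * (2 ^ m * side Q)" "2 ^ m * side Q < 2 * (2 ^ m * side P)"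
      using s[OF PQ(1)] s[OF PQ(2)] unfolding eq power_Suc by linarith+
    then have "side P < 2 * side Q" "side Q < 2 * side P"
      by (simp_all add: mult.left_commute[of 2])
    then show "P = Q"
      using dyadic_lattice_same_scale[OF D] F PQ by blast
  qed
  have le: "LlogL_average (indicator A) Q \<le> ennreal (c (s Q))" if "Q \<in> F" for Q
  proof (cases "s Q < m")
    case True
    then show ?thesis
      using LlogL_average_indicator_le_2[OF A(1), of Q] cubes that by (auto simp: c_def)
  next
    case False
    then have "2 ^ s Q = 2 ^ m * (2 :: real) ^ (s Q - m)"
      by (simp flip: power_add)
    then have "2 ^ (s Q - m) \<le> side Q"
      using s[OF that] by simp
    then show ?thesis
      using False LlogL_average_indicator_decay[OF A V, of Q "s Q - m"] cubes that by (auto simp: c_def)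
  qed
  have shift: "(\<lambda>k. c (k + m)) = (\<lambda>k. sqrt (8 * V) * ?q ^ k)"
    by (auto simp: c_def)
  have geo: "summable (\<lambda>k. ?q ^ k)"
    using q by (intro summable_geometric) simp
  then have sum: "summable c"
    using summable_iff_shift[of c m] unfolding shift by (simp add: summable_mult)
  have "(\<Sum>Q\<in>F. LlogL_average (indicator A) Q) \<le> (\<Sum>Q\<in>F. ennreal (c (s Q)))"
    by (intro sum_mono le)
  also have "\<dots> = ennreal (\<Sum>Q\<in>F. c (s Q))"
    using c by (intro sum_ennreal) auto
  also have "(\<Sum>Q\<in>F. c (s Q)) = (\<Sum>k\<in>s ` F. c k)"
    using inj by (simp add: sum.reindex)
  also have "\<dots> \<le> suminf c"
    using F(1) c by (intro sum_le_suminf sum) auto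
  also have "suminf c = (\<Sum>k. sqrt (8 * V) * ?q ^ k) + (\<Sum>k<m. c k)"
    using suminf_split_initial_segment[OF sum, of m] unfolding shift .
  also have "(\<Sum>k<m. c k) = 2 * real m"
    by (simp add: c_def)
  also have "(\<Sum>k. sqrt (8 * V) * ?q ^ k) = sqrt (8 * V) / (1 - ?q)"
    using q geo by (subst suminf_mult) (auto simp: suminf_geometric)
  finally show ?thesis
    by (simp add: add.commute ennreal_leI)
qed

section \<open>Control of the small cubes by sparseness\<close>

definition small_cubes :: "(real ^ 'n) set set \<Rightarrow> real \<Rightarrow> (real ^ 'n) set set" where
  "small_cubes S r = {Q \<in> S. side Q < r \<and> Q \<inter> ball 0 r \<noteq> {}}"

text \<open>The coefficient 2 is the uniform bound for the averages of an indicator, so f no longer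
  appears. The index set consists of the cubes meeting the ball and is independent of x; with the
  sum written as an integral over counting measure, it can be exchanged with the integral in
  x.\<close>

definition small_part :: "(real ^ 'n) set set \<Rightarrow> real \<Rightarrow> real ^ 'n \<Rightarrow> ennreal" where
  "small_part S r x = (\<integral>\<^sup>+Q. 2 * indicator Q x \<partial>count_space (small_cubes S r))"

lemma borel_measurable_nn_integral_count_space_countable:
  fixes f :: "'i \<Rightarrow> 'a \<Rightarrow> ennreal"
  assumes I: "countable I" and f: "\<And>i. i \<in> I \<Longrightarrow> f i \<in> borel_measurable M"
  shows "(\<lambda>x. \<integral>\<^sup>+i. f i x \<partial>count_space I) \<in> borel_measurable M"
proof (cases "finite I")
  case True
  then show ?thesis
    using f by (simp add: nn_integral_count_space_finite)
next
  case False
  then have "I \<noteq> {}" by auto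
  have "(\<integral>\<^sup>+i. g i \<partial>count_space I) = (\<Sum>n. g (from_nat_into I n))" for g :: "'i \<Rightarrow> ennreal"
    by (simp add: nn_integral_bij_count_space[symmetric, OF bij_betw_from_nat_into[OF I False]] nn_integral_count_space_nat)
  moreover have "(\<lambda>x. \<Sum>n. f (from_nat_into I n) x) \<in> borel_measurable M"
    using f from_nat_into[OF \<open>I \<noteq> {}\<close>] by (intro borel_measurable_suminf_order) auto
  ultimately show ?thesis by simp
qed

lemma small_part_measurable:
  fixes D :: "(real ^ 'n) set set"
  assumes "dyadic_lattice D" "S \<subseteq> D"
  shows "small_part S r \<in> borel_measurable lebesgue"
proof -
  have "countable (small_cubes S r)" "small_cubes S r \<subseteq> cubes"
    using assms dyadic_lattice_countable[OF assms(1)]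
    by (auto simp: small_cubes_def dyadic_lattice_def intro: countable_subset)
  then show ?thesis
    unfolding small_part_def[abs_def]
    by (intro borel_measurable_nn_integral_count_space_countable borel_measurable_times_ennreal
        borel_measurable_const borel_measurable_indicator) (auto intro: cubes_sets_lebesgue)
qed

text \<open>Sparseness replaces each |Q| by |E(Q)| / \<eta>. The sets E(Q) are disjoint and lie in
  the ball of radius (1 + n) r, because Q meets the ball of radius r and has diameter at most n r.
  The bound is proportional to r^n, so the mean over the ball does not depend on r.\<close>

lemma nn_integral_small_part:
  fixes D :: "(real ^ 'n) set set"
  assumes D: "dyadic_lattice D" "S \<subseteq> D" and sparse: "sparse_family \<eta> S" and \<eta>: "0 < \<eta>" and r: "0 < r"
  shows "(\<integral>\<^sup>+x. small_part S r x \<partial>lebesgue)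
    \<le> ennreal (2 / \<eta> * (unit_ball_vol (real CARD('n)) * ((1 + real CARD('n)) * r) ^ CARD('n)))"
proof -
  let ?I = "small_cubes S r"
  let ?B = "ball (0 :: real ^ 'n) ((1 + real CARD('n)) * r)"
  obtain E where E: "\<And>Q. Q \<in> S \<Longrightarrow> E Q \<in> sets lebesgue" "\<And>Q. Q \<in> S \<Longrightarrow> E Q \<subseteq> Q"
      "\<And>Q. Q \<in> S \<Longrightarrow> \<eta> * measure lebesgue Q \<le> measure lebesgue (E Q)"
    and disj: "disjoint_family_on E S"
    using sparse unfolding sparse_family_def by blast
  have IS: "?I \<subseteq> S"
    by (auto simp: small_cubes_def)
  have cubes: "S \<subseteq> cubes"
    using D by (auto simp: dyadic_lattice_def)
  have countable: "countable ?I"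
    using IS D(2) dyadic_lattice_countable[OF D(1)] by (meson countable_subset)
  have sets: "Q \<in> sets lebesgue" if "Q \<in> ?I" for Q
    using that IS cubes cubes_sets_lebesgue by blast
  have sub: "E Q \<subseteq> ?B" if Q: "Q \<in> ?I" for Q
  proof
    fix z
    assume "z \<in> E Q"
    then have z: "z \<in> Q"
      using E(2) Q IS by blast
    obtain y where y: "y \<in> Q" "norm y < r"
      using Q by (auto simp: small_cubes_def)
    obtain a where Qc: "Q = cube a (side Q)"
      using Q IS cubes by (meson cubesE subsetD)
    have "norm (z - y) \<le> real CARD('n) * side Q"
      by (rule norm_diff_cube_le[of _ a]) (use z y Qc in auto)
    also have "\<dots> \<le> real CARD('n) * r"
      using Q by (intro mult_left_mono) (auto simp: small_cubes_def)
    finally have "norm z < (1 + real CARD('n)) * r"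
      using y(2) norm_triangle_sub[of z y] by (simp add: distrib_right)
    then show "z \<in> ?B" by simp
  qed
  have le: "2 * emeasure lebesgue Q \<le> ennreal (2 / \<eta>) * emeasure lebesgue (E Q)" if "Q \<in> ?I" for Q
  proof -
    have Q: "Q \<in> S" "Q \<in> cubes"
      using that IS cubes by auto
    \<comment> \<open>Sparseness is stated with real-valued measures; passing to extended values
      needs finiteness, which E(Q) inherits from the cube containing it.\<close>
    have fin: "emeasure lebesgue Q = ennreal (measure lebesgue Q)"
      using emeasure_cubes[OF Q(2)] by (intro emeasure_eq_ennreal_measure) simp
    have "emeasure lebesgue (E Q) \<le> emeasure lebesgue Q"
      using E(2)[OF Q(1)] sets[OF that] by (rule emeasure_mono)
    then have fin': "emeasure lebesgue (E Q) = ennreal (measure lebesgue (E Q))"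
      using emeasure_cubes[OF Q(2)] by (intro emeasure_eq_ennreal_measure) (auto simp: top_unique)
    have "2 * measure lebesgue Q \<le> 2 / \<eta> * measure lebesgue (E Q)"
      using E(3)[OF Q(1)] \<eta> by (simp add: field_simps)
    then have "ennreal (2 * measure lebesgue Q) \<le> ennreal (2 / \<eta> * measure lebesgue (E Q))"
      by (rule ennreal_leI)
    moreover have "ennreal (2 * measure lebesgue Q) = 2 * ennreal (measure lebesgue Q)"
      by (simp add: ennreal_mult')
    moreover have "ennreal (2 / \<eta> * measure lebesgue (E Q)) = ennreal (2 / \<eta>) * ennreal (measure lebesgue (E Q))"
      using \<eta> by (intro ennreal_mult') simp
    ultimately show ?thesis
      unfolding fin fin' by (simp only:)
  qed
  have "(\<integral>\<^sup>+x. small_part S r x \<partial>lebesgue) = (\<integral>\<^sup>+Q. \<integral>\<^sup>+x. 2 * indicator Q x \<partial>lebesgue \<partial>count_space ?I)"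
    unfolding small_part_def using sets by (intro nn_integral_count_space_nn_integral countable) auto
  also have "\<dots> = (\<integral>\<^sup>+Q. 2 * emeasure lebesgue Q \<partial>count_space ?I)"
    using sets by (intro nn_integral_cong) (simp add: nn_integral_cmult_indicator)
  also have "\<dots> \<le> (\<integral>\<^sup>+Q. ennreal (2 / \<eta>) * emeasure lebesgue (E Q) \<partial>count_space ?I)"
    using le by (intro nn_integral_mono) simp
  also have "\<dots> = ennreal (2 / \<eta>) * (\<integral>\<^sup>+Q. emeasure lebesgue (E Q) \<partial>count_space ?I)"
    by (rule nn_integral_cmult) simp
  also have "(\<integral>\<^sup>+Q. emeasure lebesgue (E Q) \<partial>count_space ?I) = emeasure lebesgue (\<Union>(E ` ?I))"
    using E(1) IS disj countable by (intro emeasure_UN_countable[symmetric]) (auto intro: disjoint_family_on_mono)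
  also have "ennreal (2 / \<eta>) * \<dots> \<le> ennreal (2 / \<eta>) * emeasure lebesgue ?B"
    using sub by (intro mult_left_mono emeasure_mono) auto
  also have "emeasure lebesgue ?B = ennreal (unit_ball_vol (real CARD('n)) * ((1 + real CARD('n)) * r) ^ CARD('n))"
    using r emeasure_ball[of "(1 + real CARD('n)) * r" "0 :: real ^ 'n"] by simp
  also have "ennreal (2 / \<eta>) * \<dots>
      = ennreal (2 / \<eta> * (unit_ball_vol (real CARD('n)) * ((1 + real CARD('n)) * r) ^ CARD('n)))"
    using \<eta> by (intro ennreal_mult'[symmetric]) simp
  finally show ?thesis .
qed

text \<open>The infinite sum is the supremum of its finite partial sums, and each of these is split
  at side 2^-m. A small cube containing x meets the ball because x lies in it, so it is counted in
  \<open>small_part\<close>.\<close>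

lemma sparse_LlogL_indicator_le:
  fixes D :: "(real ^ 'n) set set"
  assumes D: "dyadic_lattice D" "S \<subseteq> D"
    and A: "A \<in> sets lebesgue" "emeasure lebesgue A \<le> ennreal V" and V: "0 < V"
    and x: "norm x < (1 / 2) ^ m"
  shows "sparse_LlogL S (indicator A) x
    \<le> ennreal (2 * real m + sqrt (8 * V) / (1 - sqrt (1 / 2))) + small_part S ((1 / 2) ^ m) x"
proof -
  let ?r = "(1 / 2) ^ m :: real"
  let ?L = "LlogL_average (indicator A)"
  have cubes: "S \<subseteq> cubes"
    using D by (auto simp: dyadic_lattice_def)
  have "(\<Sum>Q\<in>F. ?L Q * indicator Q x) \<le> ennreal (2 * real m + sqrt (8 * V) / (1 - sqrt (1 / 2))) + small_part S ?r x"
    if F: "finite F" "F \<subseteq> S" for F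
  proof -
    define F1 where "F1 = {Q \<in> F. x \<in> Q \<and> ?r \<le> side Q}"
    define F2 where "F2 = {Q \<in> F. x \<in> Q \<and> side Q < ?r}"
    have fin: "finite F1" "finite F2"
      using F by (auto simp: F1_def F2_def)
    have F2: "F2 \<subseteq> small_cubes S ?r"
      using F x by (auto simp: F2_def small_cubes_def)
    have "(\<Sum>Q\<in>F. ?L Q * indicator Q x) = (\<Sum>Q\<in>F1 \<union> F2. ?L Q * indicator Q x)"
      using F by (intro sum.mono_neutral_right) (auto simp: F1_def F2_def not_le indicator_def split: if_splits)
    also have "\<dots> = (\<Sum>Q\<in>F1. ?L Q * indicator Q x) + (\<Sum>Q\<in>F2. ?L Q * indicator Q x)"
      using fin by (intro sum.union_disjoint) (auto simp: F1_def F2_def)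
    also have "(\<Sum>Q\<in>F1. ?L Q * indicator Q x) = (\<Sum>Q\<in>F1. ?L Q)"
      by (intro sum.cong) (auto simp: F1_def)
    also have "\<dots> \<le> ennreal (2 * real m + sqrt (8 * V) / (1 - sqrt (1 / 2)))"
      by (rule large_cubes_sum[OF D(1) A V fin(1), of x]) (use F D in \<open>auto simp: F1_def\<close>)
    also have "(\<Sum>Q\<in>F2. ?L Q * indicator Q x) \<le> (\<Sum>Q\<in>F2. 2 * indicator Q x)"
      using LlogL_average_indicator_le_2[OF A(1)] cubes F
      by (intro sum_mono mult_right_mono) (auto simp: F2_def)
    also have "\<dots> = (\<integral>\<^sup>+Q. (2 * indicator Q x) * indicator F2 Q \<partial>count_space (small_cubes S ?r))"
      using fin F2 by (subst nn_integral_count_space'[of F2]) (auto intro!: sum.cong)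
    also have "\<dots> \<le> small_part S ?r x"
      unfolding small_part_def by (intro nn_integral_mono) (auto simp: indicator_def)
    finally show ?thesis
      by (simp add: add_left_mono add_right_mono)
  qed
  then show ?thesis
    unfolding sparse_LlogL_def by (subst nonneg_infsum_complete) (auto intro!: SUP_least)
qed

section \<open>Quadratic against linear growth in m\<close>

theorem mainTheorem2:
  fixes \<eta> :: real
  assumes "0 < \<eta>" and "\<eta> < 1"
  shows "\<not> (\<exists>N::nat. \<forall>(T :: (real ^ 'n \<Rightarrow> real) \<Rightarrow> real ^ 'n \<Rightarrow> real) b.
            calderon_zygmund T \<and> b \<in> BMO \<longrightarrow>
            (\<exists>c\<ge>0. \<forall>f\<in>Linfty_c. \<exists>D S.
               (\<forall>j\<in>{1..N}. dyadic_lattice (D j) \<and> S j \<subseteq> D j \<and> sparse_family \<eta> (S j)) \<and>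
               (AE x in lebesgue.
                  ennreal \<bar>commutator b T f x\<bar> \<le> ennreal c * (\<Sum>j=1..N. sparse_LlogL (S j) f x))))"
proof
  let ?n = "CARD('n)"
  define V where "V = unit_ball_vol (real ?n)"
  have V: "0 < V"
    by (simp add: V_def)
  \<comment> \<open>The part of the mean of a single sparse sum that does not grow with m: the
    geometric tail over scales from 1 upward, and the mean of the small cubes.\<close>
  define C where "C = sqrt (8 * V) / (1 - sqrt (1 / 2)) + 2 / \<eta> * (1 + real ?n) ^ ?n"
  define c0 where "c0 = ln 2 * V / 4 ^ ?n"
  have c0: "0 < c0"
    using V by (simp add: c0_def)
  have C: "0 \<le> C"
    using V assms(1) by (simp add: C_def)
  let ?b = "\<lambda>x :: real ^ 'n. ln (norm x)"
  let ?T = "hardy_operator :: (real ^ 'n \<Rightarrow> real) \<Rightarrow> real ^ 'n \<Rightarrow> real"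
  assume "\<exists>N::nat. \<forall>(T :: (real ^ 'n \<Rightarrow> real) \<Rightarrow> real ^ 'n \<Rightarrow> real) b.
            calderon_zygmund T \<and> b \<in> BMO \<longrightarrow>
            (\<exists>c\<ge>0. \<forall>f\<in>Linfty_c. \<exists>D S.
               (\<forall>j\<in>{1..N}. dyadic_lattice (D j) \<and> S j \<subseteq> D j \<and> sparse_family \<eta> (S j)) \<and>
               (AE x in lebesgue.
                  ennreal \<bar>commutator b T f x\<bar> \<le> ennreal c * (\<Sum>j=1..N. sparse_LlogL (S j) f x)))"
  then obtain N :: nat where N: "\<forall>(T :: (real ^ 'n \<Rightarrow> real) \<Rightarrow> real ^ 'n \<Rightarrow> real) b.
            calderon_zygmund T \<and> b \<in> BMO \<longrightarrow>
            (\<exists>c\<ge>0. \<forall>f\<in>Linfty_c. \<exists>D S.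
               (\<forall>j\<in>{1..N}. dyadic_lattice (D j) \<and> S j \<subseteq> D j \<and> sparse_family \<eta> (S j)) \<and>
               (AE x in lebesgue.
                  ennreal \<bar>commutator b T f x\<bar> \<le> ennreal c * (\<Sum>j=1..N. sparse_LlogL (S j) f x)))"
    by (rule exE)
  obtain c where c: "0 \<le> c" and dom: "\<forall>f\<in>Linfty_c. \<exists>D S.
               (\<forall>j\<in>{1..N}. dyadic_lattice (D j) \<and> S j \<subseteq> D j \<and> sparse_family \<eta> (S j)) \<and>
               (AE x in lebesgue.
                  ennreal \<bar>commutator ?b ?T f x\<bar> \<le> ennreal c * (\<Sum>j=1..N. sparse_LlogL (S j) f x))"
    using N[rule_format, of ?T ?b] calderon_zygmund_hardy ln_norm_BMO by blast
  \<comment> \<open>The domination is integrated over the ball of radius 2^-m and divided by the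
    volume of that ball. Nothing but m varies here, since c and N are already fixed.\<close>
  have bound: "c0 * (\<Sum>k<m. real k) \<le> c * N * (2 * real m + C)" for m :: nat
  proof -
    define r :: real where "r = (1 / 2) ^ m"
    have r: "0 < r" by (simp add: r_def)
    let ?A = "annulus r 1 :: (real ^ 'n) set"
    let ?f = "indicator ?A :: real ^ 'n \<Rightarrow> real"
    let ?B = "ball (0 :: real ^ 'n) r"
    let ?s = "\<Sum>k<m. real k"
    define K where "K = 2 * real m + sqrt (8 * V) / (1 - sqrt (1 / 2))"
    have K: "0 \<le> K"
      using V by (simp add: K_def)
    obtain D S where DS: "\<And>j. j \<in> {1..N} \<Longrightarrow> dyadic_lattice (D j) \<and> S j \<subseteq> D j \<and> sparse_family \<eta> (S j)"
      and ae: "AE x in lebesgue. ennreal \<bar>commutator ?b ?T ?f x\<bar> \<le> ennreal c * (\<Sum>j=1..N. sparse_LlogL (S j) ?f x)"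
      using dom indicator_annulus_Linfty_c[of r 1] by blast
    \<comment> \<open>The annulus stays in the unit ball for every m, so the tail constant in K is
      independent of m.\<close>
    have "emeasure lebesgue ?A \<le> emeasure lebesgue (ball (0 :: real ^ 'n) 1)"
      by (intro emeasure_mono) (auto simp: annulus_def)
    also have "\<dots> = ennreal V"
      using emeasure_ball[of 1 "0 :: real ^ 'n"] by (simp add: V_def)
    finally have A: "emeasure lebesgue ?A \<le> ennreal V" .
    have B: "emeasure lebesgue ?B = ennreal (V * r ^ ?n)"
      using emeasure_ball[of r "0 :: real ^ 'n"] r by (simp add: V_def)
    have small: "(\<integral>\<^sup>+x. small_part (S j) r x \<partial>lebesgue) \<le> ennreal (2 / \<eta> * (1 + real ?n) ^ ?n * (V * r ^ ?n))"
      if "j \<in> {1..N}" for j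
      using nn_integral_small_part[of "D j" "S j" \<eta> r] DS[OF that] assms(1) r
      by (simp add: V_def power_mult_distrib mult_ac)
    have meas: "small_part (S j) r \<in> borel_measurable lebesgue" if "j \<in> {1..N}" for j
      using small_part_measurable DS[OF that] by blast
    have "AE x in lebesgue. x \<noteq> (0 :: real ^ 'n)"
      by (rule AE_completion[OF AE_lborel_singleton])
    \<comment> \<open>The estimates hold only on the ball, hence the indicators.
      \<open>small_part\<close> carries none: it is nonnegative, and its integral over the whole
      space is the quantity controlled.\<close>
    with ae have "AE x in lebesgue. ennreal (c0 * ?s) * indicator ?B x
        \<le> ennreal c * (\<Sum>j=1..N. ennreal K * indicator ?B x + small_part (S j) r x)"
    proof eventually_elim
      case (elim x)
      show ?case
      proof (cases "x \<in> ?B")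
        case True
        then have x: "norm x < (1 / 2) ^ m"
          by (simp add: r_def)
        have "ennreal (c0 * ?s) \<le> ennreal \<bar>commutator ?b ?T ?f x\<bar>"
          using commutator_lower_bound[OF elim(2) x] by (intro ennreal_leI) (simp add: c0_def V_def r_def)
        also have "\<dots> \<le> ennreal c * (\<Sum>j=1..N. sparse_LlogL (S j) ?f x)"
          by (rule elim(1))
        also have "\<dots> \<le> ennreal c * (\<Sum>j=1..N. ennreal K + small_part (S j) r x)"
        proof (intro mult_left_mono sum_mono)
          fix j
          assume "j \<in> {1..N}"
          then show "sparse_LlogL (S j) ?f x \<le> ennreal K + small_part (S j) r x"
            using sparse_LlogL_indicator_le[of "D j" "S j" ?A V x m] DS A V x
            by (simp add: K_def r_def del: ennreal_plus)
        qed simp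
        finally show ?thesis
          using True by simp
      qed simp
    qed
    then have "(\<integral>\<^sup>+x. ennreal (c0 * ?s) * indicator ?B x \<partial>lebesgue)
        \<le> (\<integral>\<^sup>+x. ennreal c * (\<Sum>j=1..N. ennreal K * indicator ?B x + small_part (S j) r x) \<partial>lebesgue)"
      by (rule nn_integral_mono_AE)
    also have "\<dots> = ennreal c * (\<Sum>j=1..N. ennreal K * emeasure lebesgue ?B + (\<integral>\<^sup>+x. small_part (S j) r x \<partial>lebesgue))"
    proof -
      have K_ind: "(\<lambda>x. ennreal K * indicator ?B x) \<in> borel_measurable lebesgue"
        by (intro borel_measurable_times_ennreal borel_measurable_const borel_measurable_indicator) simp
      have "(\<integral>\<^sup>+x. ennreal K * indicator ?B x + small_part (S j) r x \<partial>lebesgue)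
          = ennreal K * emeasure lebesgue ?B + (\<integral>\<^sup>+x. small_part (S j) r x \<partial>lebesgue)" if "j \<in> {1..N}" for j
        by (subst nn_integral_add) (use that meas K_ind in \<open>auto simp: nn_integral_cmult_indicator\<close>)
      moreover have "(\<lambda>x. ennreal K * indicator ?B x + small_part (S j) r x) \<in> borel_measurable lebesgue" if "j \<in> {1..N}" for j
        using meas[OF that] K_ind by (intro borel_measurable_add) auto
      ultimately show ?thesis
        by (subst nn_integral_cmult, intro borel_measurable_sum, simp, subst nn_integral_sum, simp, simp)
    qed
    also have "\<dots> \<le> ennreal c * (\<Sum>j=1..N. ennreal K * ennreal (V * r ^ ?n) + ennreal (2 / \<eta> * (1 + real ?n) ^ ?n * (V * r ^ ?n)))"
      unfolding B using small by (intro mult_left_mono sum_mono add_mono) auto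
    also have "\<dots> = ennreal (c * N * (2 * real m + C) * (V * r ^ ?n))"
    proof -
      have "ennreal K * ennreal (V * r ^ ?n) + ennreal (2 / \<eta> * (1 + real ?n) ^ ?n * (V * r ^ ?n))
          = ennreal (K * (V * r ^ ?n) + 2 / \<eta> * (1 + real ?n) ^ ?n * (V * r ^ ?n))"
        using K V r assms(1) by (simp add: ennreal_mult)
      also have "K * (V * r ^ ?n) + 2 / \<eta> * (1 + real ?n) ^ ?n * (V * r ^ ?n) = (2 * real m + C) * (V * r ^ ?n)"
        by (simp add: K_def C_def distrib_right)
      finally show ?thesis
        using c C V r by (simp add: ennreal_of_nat_eq_real_of_nat ennreal_mult' mult.assoc)
    qed
    finally have "ennreal (c0 * ?s) * ennreal (V * r ^ ?n) \<le> ennreal (c * N * (2 * real m + C) * (V * r ^ ?n))"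
      using B by (simp add: nn_integral_cmult_indicator)
    then have "ennreal (c0 * ?s * (V * r ^ ?n)) \<le> ennreal (c * N * (2 * real m + C) * (V * r ^ ?n))"
      using c0 V r by (simp add: ennreal_mult sum_nonneg)
    then have "c0 * ?s * (V * r ^ ?n) \<le> c * N * (2 * real m + C) * (V * r ^ ?n)"
      using c C V r by (subst (asm) ennreal_le_iff) auto
    then show ?thesis
      using V r by (simp add: mult_le_cancel_right)
  qed
  \<comment> \<open>After the factor m + 1 is cancelled below, what remains is c0 m / 2 \<le> c N (2
    + C), which this choice of m violates.\<close>
  obtain m :: nat where m: "2 * (c * N * (2 + C) + 1) / c0 < m"
    using reals_Archimedean2 by blast
  \<comment> \<open>Taking the bound at \<open>Suc m\<close> makes m + 1 a factor of the left-hand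
    side; on the right 2 (m + 1) + C \<le> (2 + C) (m + 1), so it cancels.\<close>
  have "(\<Sum>k<Suc m. real k) = real m * (real m + 1) / 2"
    by (induction m) (simp_all add: field_simps)
  then have "c0 * (real m * (real m + 1) / 2) \<le> c * N * (2 * (real m + 1) + C)"
    using bound[of "Suc m"] by (simp only: of_nat_Suc add.commute)
  also have "\<dots> \<le> c * N * ((2 + C) * (real m + 1))"
    using c C by (intro mult_left_mono) (auto simp: algebra_simps)
  finally have "(c0 * real m / 2) * (real m + 1) \<le> (c * N * (2 + C)) * (real m + 1)"
    by (simp add: mult.assoc)
  then have "c0 * real m / 2 \<le> c * N * (2 + C)"
    by (rule mult_right_le_imp_le) simp
  then show False
    using m c0 by (simp add: field_simps)
qed

end
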